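(* Let $\Phi(z)\in\mathbb{R}(z)^{m\times m}$ be a spectral density of normal rank $r\le m$. Let $W_-(z)\in\mathbb{R}(z)^{m\times r}$ be the outer spectral factor of $\Phi(z)$ and let $\overline{W}_+(z)\in\mathbb{R}(z)^{m\times r}$ be the conjugate outer spectral factor of $\Phi(z)$. Let $T(z):=W_-^{-L}(z)\,\overline{W}_+(z)\in\mathbb{R}(z)^{r\times r}$, where $W_-^{-L}(z)$ denotes a (rational) left inverse of $W_-(z)$. Let $\mathscr{W}$ be the set of minimal spectral factors of $\Phi(z)$. Then $$\mathscr{W}=\{\,W_-(z)\,T_\ell(z)\ :\ T_\ell(z)\ \text{is a left all-pass divisor of } T(z)\,\}.$$
   Context: Notation. $\mathbb{R}(z)^{m\times n}$ is the set of $m\times n$ matrices of real rational functions, and $\overline{\mathbb{C}}:=\mathbb{C}\cup\{\infty\}$. For $G(z)\in\mathbb{R}(z)^{m\times n}$, $G^*(z):=G^{\top}(1/z)$. The normal rank of $G(z)$ is its rank at almost every $z\in\mathbb{C}$ (equivalently, its rank over the field $\mathbb{R}(z)$). For $\alpha\in\overline{\mathbb{C}}$, $\delta(G;\alpha)$ denotes the degree of the pole of $G(z)$ at $\alpha$ (the largest multiplicity with which $\alpha$ occurs as a pole of any minor of $G(z)$, of any order), with $\delta(G;\alpha)=0$ if $\alpha$ is not a pole of $G(z)$. The McMillan degree is $\delta_M(G):=\sum_i\delta(G;\alpha_i)$, where $\{\alpha_i\}\subset\overline{\mathbb{C}}$ is the set of poles of $G(z)$, including possibly $\infty$. Spectral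 densities. $G(z)\in\mathbb{R}(z)^{m\times m}$ is para-Hermitian if $G(z)=G^*(z)$. A para-Hermitian $\Phi(z)\in\mathbb{R}(z)^{m\times m}$ is a spectral density if $\Phi(e^{j\vartheta})$ is positive semi-definite for all $\vartheta\in[0,2\pi)$ for which it is defined. No further assumption is made: $\Phi$ may be rank-deficient, may have poles and zeros on the unit circle, and may have poles or zeros at infinity. Spectral factors. Let $\Phi(z)$ be a spectral density of normal rank $r$. A spectral factor of $\Phi(z)$ is a matrix $W(z)\in\mathbb{R}(z)^{m\times r}$ such that $\Phi(z)=W(z)W^*(z)$. It is called a minimal spectral factor if $\delta_M(W)=\tfrac12\delta_M(\Phi)$. The outer (minimum-phase) spectral factor $W_-(z)$ is the minimal spectral factor that is analytic together with its inverse in $\{z\in\overline{\mathbb{C}}:|z|>1\}$. The conjugate outer spectral factor $\overline{W}_+(z)$ is the minimal spectral factor that is analytic together with its inverse in $\{z\in\overline{\mathbb{C}}:|z|<1\}$. When $r<m$, "inverse" means left inverse, i.e. there exists a rational left inverse analytic in the indicated region. These two factors exist and are unique up to right multiplication by a constant real orthogonal $r\times r$ matrix; $W_-$ and $\overline{W}_+$ denote any fixed choices. The matrix $T(z)$ does not depend on which rational left inverse $W_-^{-L}(z)$ is chosen, because $W_-(z)$ and $\overline{W}_+(z)$ have the same column space over $\mathbb{R}(z)$. All-pass functions. $G(z)\in\mathbb{R}(z)^{r\times r}$ is all-pass if $G^*(z)G(z)=G(z)G^*(z)=I_r$. If $G_\ell(z),G_r(z)\in\mathbb{R}(z)^{r\times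 r}$ are all-pass, $G(z)=G_\ell(z)G_r(z)$, and $\delta_M(G_\ell)+\delta_M(G_r)=\delta_M(G)$, then $G_\ell(z)$ is called a left all-pass divisor of $G(z)$ and $G_r(z)$ a right all-pass divisor of $G(z)$. The matrix $T(z)$ in the claim is all-pass; it is called the conjugate phase function of $\Phi$. *)

theory Defs
  imports
    "Jordan_Normal_Form.DL_Rank_Submatrix"
    "HOL-Computational_Algebra.Computational_Algebra"
    "HOL-Computational_Algebra.Field_as_Ring"
begin

section \<open>Real rational functions\<close>

type_synonym ratfun = "real poly fract"

text \<open>
  Evaluation of \<open>p / q\<close>, in lowest terms, at a point \<open>x\<close> of a field extension of the reals
  with embedding \<open>h\<close>. It is meaningful only if \<open>q\<close> does not vanish at \<open>x\<close>.
\<close>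

definition rat_eval :: "(real \<Rightarrow> 'a::field) \<Rightarrow> ratfun \<Rightarrow> 'a \<Rightarrow> 'a" where
  "rat_eval h f x =
     (case quot_of_fract f of (p, q) \<Rightarrow> poly (map_poly h p) x / poly (map_poly h q) x)"

definition zvar :: ratfun where
  "zvar = to_fract [:0, 1:]"

text \<open>
  The rational function \<open>f(1/z)\<close>: evaluation of \<open>f\<close> at the element \<open>1/z\<close> of the field of rational
  functions. As \<open>1/z\<close> is transcendental over the reals, the denominator never vanishes.
\<close>

definition rat_reflect :: "ratfun \<Rightarrow> ratfun" where
  "rat_reflect f = rat_eval (\<lambda>c. to_fract [:c:]) f (1 / zvar)"

definition para_conj :: "ratfun mat \<Rightarrow> ratfun mat" where
  "para_conj G = transpose_mat (map_mat rat_reflect G)"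


section \<open>Poles and McMillan degree\<close>

datatype ext_complex = Finite complex | Infinity

definition outside_disc :: "ext_complex set" where
  "outside_disc = insert Infinity (Finite ` {z. cmod z > 1})"

definition inside_disc :: "ext_complex set" where
  "inside_disc = Finite ` {z. cmod z < 1}"

text \<open>
  Multiplicity of a point as a pole of a scalar rational function, \<open>0\<close> if it is not a pole.
  Numerator and denominator returned by \<^const>\<open>quot_of_fract\<close> are coprime, and the natural number
  subtraction truncates at \<open>0\<close>.
\<close>

fun pole_mult :: "ratfun \<Rightarrow> ext_complex \<Rightarrow> nat" where
  "pole_mult f (Finite a) = Polynomial.order a (map_poly complex_of_real (snd (quot_of_fract f)))"
| "pole_mult f Infinity = degree (fst (quot_of_fract f)) - degree (snd (quot_of_fract f))"

definition poles :: "ratfun mat \<Rightarrow> ext_complex set" where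
  "poles G = {\<alpha>. \<exists>i < dim_row G. \<exists>j < dim_col G. pole_mult (G $$ (i, j)) \<alpha> > 0}"

text \<open>
  The empty minor, equal to \<open>1\<close> and without poles, is included; so the maximum is taken over a
  nonempty finite set and is \<open>0\<close> at points that are not poles.
\<close>

definition pole_degree :: "ratfun mat \<Rightarrow> ext_complex \<Rightarrow> nat" where
  "pole_degree G \<alpha> =
     Max {pole_mult (det (submatrix G I J)) \<alpha> | I J.
            I \<subseteq> {..<dim_row G} \<and> J \<subseteq> {..<dim_col G} \<and> card I = card J}"

definition mcmillan_degree :: "ratfun mat \<Rightarrow> nat" where
  "mcmillan_degree G = (\<Sum>\<alpha>\<in>poles G. pole_degree G \<alpha>)"

definition analytic_in :: "ratfun mat \<Rightarrow> ext_complex set \<Rightarrow> bool" where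
  "analytic_in G S \<longleftrightarrow> poles G \<inter> S = {}"

definition left_inverse_of :: "ratfun mat \<Rightarrow> ratfun mat \<Rightarrow> bool" where
  "left_inverse_of L G \<longleftrightarrow>
     L \<in> carrier_mat (dim_col G) (dim_row G) \<and> L * G = 1\<^sub>m (dim_col G)"

definition normal_rank :: "ratfun mat \<Rightarrow> nat" where
  "normal_rank G = vec_space.rank (dim_row G) G"


section \<open>Spectral densities\<close>

text \<open>
  With the order of \<^theory>\<open>HOL-Library.Complex_Order\<close>, \<open>0 \<le> w\<close> says that \<open>w\<close> is real and
  nonnegative; hence a positive semidefinite matrix is automatically Hermitian.
\<close>

definition pos_semidef :: "complex mat \<Rightarrow> bool" where
  "pos_semidef A \<longleftrightarrow>
     square_mat A \<and> (\<forall>v \<in> carrier_vec (dim_row A). 0 \<le> (A *\<^sub>v v) \<bullet>c v)"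

definition mat_eval :: "ratfun mat \<Rightarrow> complex \<Rightarrow> complex mat" where
  "mat_eval G a = map_mat (\<lambda>f. rat_eval complex_of_real f a) G"

definition para_hermitian :: "ratfun mat \<Rightarrow> bool" where
  "para_hermitian G \<longleftrightarrow> square_mat G \<and> para_conj G = G"

definition spectral_density :: "ratfun mat \<Rightarrow> bool" where
  "spectral_density \<Phi> \<longleftrightarrow>
     para_hermitian \<Phi> \<and>
     (\<forall>\<theta> \<in> {0..<2 * pi}. Finite (cis \<theta>) \<notin> poles \<Phi> \<longrightarrow> pos_semidef (mat_eval \<Phi> (cis \<theta>)))"


section \<open>Spectral factors\<close>

definition spectral_factor :: "ratfun mat \<Rightarrow> ratfun mat \<Rightarrow> bool" where
  "spectral_factor \<Phi> W \<longleftrightarrow>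
     W \<in> carrier_mat (dim_row \<Phi>) (normal_rank \<Phi>) \<and> \<Phi> = W * para_conj W"

definition minimal_spectral_factor :: "ratfun mat \<Rightarrow> ratfun mat \<Rightarrow> bool" where
  "minimal_spectral_factor \<Phi> W \<longleftrightarrow>
     spectral_factor \<Phi> W \<and> real (mcmillan_degree W) = 1/2 * real (mcmillan_degree \<Phi>)"

definition analytic_with_left_inverse :: "ratfun mat \<Rightarrow> ext_complex set \<Rightarrow> bool" where
  "analytic_with_left_inverse W S \<longleftrightarrow>
     analytic_in W S \<and> (\<exists>L. left_inverse_of L W \<and> analytic_in L S)"

definition outer_spectral_factor :: "ratfun mat \<Rightarrow> ratfun mat \<Rightarrow> bool" where
  "outer_spectral_factor \<Phi> W \<longleftrightarrow>
     minimal_spectral_factor \<Phi> W \<and> analytic_with_left_inverse W outside_disc"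

definition conjugate_outer_spectral_factor :: "ratfun mat \<Rightarrow> ratfun mat \<Rightarrow> bool" where
  "conjugate_outer_spectral_factor \<Phi> W \<longleftrightarrow>
     minimal_spectral_factor \<Phi> W \<and> analytic_with_left_inverse W inside_disc"


section \<open>All-pass functions\<close>

definition all_pass :: "nat \<Rightarrow> ratfun mat \<Rightarrow> bool" where
  "all_pass r G \<longleftrightarrow>
     G \<in> carrier_mat r r \<and> para_conj G * G = 1\<^sub>m r \<and> G * para_conj G = 1\<^sub>m r"

definition left_all_pass_divisor :: "nat \<Rightarrow> ratfun mat \<Rightarrow> ratfun mat \<Rightarrow> bool" where
  "left_all_pass_divisor r Gl G \<longleftrightarrow>
     all_pass r Gl \<and>
     (\<exists>Gr. all_pass r Gr \<and> G = Gl * Gr \<and>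
           mcmillan_degree Gl + mcmillan_degree Gr = mcmillan_degree G)"

end

theory Submission
  imports Defs "Jordan_Normal_Form.Char_Poly"
begin

text \<open>
  Every spectral factor is \<open>W = W_minus * Tl\<close> with \<open>Tl = L * W\<close> all-pass; put \<open>Tr = Tl\<^sup>* T\<close>, so
  \<open>T = Tl Tr\<close> and \<open>W = W_plus Tr\<^sup>*\<close>. Since \<open>W_minus\<close> and \<open>W_plus\<close> are units outside and inside the
  disc and all-pass matrices have no poles on the circle, the McMillan degree of \<open>W\<close> is the sum of
  the pole degrees of \<open>Tl\<close> and \<open>Tr\<close> outside the disc plus a contribution of the circle that does not
  depend on \<open>W\<close>. The defect \<open>\<delta>(Tl; \<alpha>) + \<delta>(Tr; \<alpha>) - \<delta>(T; \<alpha>)\<close> takes the same value at \<open>\<alpha>\<close> and \<open>1/\<alpha>\<close>,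
  because \<open>\<delta>(A\<inverse>; \<alpha>) = \<delta>(A; \<alpha>) + v\<^sub>\<alpha>(det A)\<close> by Jacobi's complementary minor theorem. Hence the
  total defect of the factorization \<open>T = Tl Tr\<close> is twice the excess of the McMillan degree of \<open>W\<close>
  over that of \<open>W_minus\<close>, and one vanishes iff the other does.
\<close>

section \<open>Minors\<close>

text \<open>Arbitrary index maps replace index sets, so that rows and columns can be permuted or
  repeated; the sums over all maps in the Cauchy-Binet formula need this freedom.\<close>

definition minor_mat :: "'a mat \<Rightarrow> nat \<Rightarrow> (nat \<Rightarrow> nat) \<Rightarrow> (nat \<Rightarrow> nat) \<Rightarrow> 'a mat" where
  "minor_mat A k f g = mat k k (\<lambda>(i, j). A $$ (f i, g j))"

lemma minor_mat_carrier [simp]: "minor_mat A k f g \<in> carrier_mat k k"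
  by (simp add: minor_mat_def)

lemma minor_mat_index [simp]:
  "i < k \<Longrightarrow> j < k \<Longrightarrow> minor_mat A k f g $$ (i, j) = A $$ (f i, g j)"
  by (simp add: minor_mat_def)

lemma minor_mat_dim [simp]: "dim_row (minor_mat A k f g) = k" "dim_col (minor_mat A k f g) = k"
  by (simp_all add: minor_mat_def)

lemma det_minor_permute_rows:
  fixes A :: "'a::comm_ring_1 mat"
  assumes "p permutes {0..<k}"
  shows "det (minor_mat A k (f \<circ> p) g) = signof p * det (minor_mat A k f g)"
proof -
  have "minor_mat A k (f \<circ> p) g = mat k k (\<lambda>(i, j). minor_mat A k f g $$ (p i, j))"
    using permutes_in_image[OF assms] by (intro eq_matI) auto
  then show ?thesis
    using det_permute_rows[OF minor_mat_carrier assms] by metis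
qed

lemma det_minor_permute_cols:
  fixes A :: "'a::comm_ring_1 mat"
  assumes p: "p permutes {0..<k}"
  shows "det (minor_mat A k f (g \<circ> p)) = signof p * det (minor_mat A k f g)"
proof -
  have "transpose_mat (minor_mat A k f (g \<circ> p))
      = mat k k (\<lambda>(i, j). transpose_mat (minor_mat A k f g) $$ (p i, j))"
    using permutes_in_image[OF p] by (intro eq_matI) auto
  then have "det (transpose_mat (minor_mat A k f (g \<circ> p)))
      = signof p * det (transpose_mat (minor_mat A k f g))"
    using det_permute_rows[OF _ p, of "transpose_mat (minor_mat A k f g)"] by simp
  then show ?thesis by (metis det_transpose minor_mat_carrier)
qed

lemma det_minor_not_inj_rows:
  fixes A :: "'a::comm_ring_1 mat"
  assumes "\<not> inj_on f {0..<k}"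
  shows "det (minor_mat A k f g) = 0"
proof -
  from assms obtain i j where ij: "i < k" "j < k" "i \<noteq> j" "f i = f j"
    by (auto simp: inj_on_def)
  show ?thesis
    by (rule det_identical_rows[OF minor_mat_carrier ij(3,1,2)])
      (rule eq_vecI, use ij in auto)
qed

lemma det_minor_not_inj_cols:
  fixes A :: "'a::comm_ring_1 mat"
  assumes "\<not> inj_on g {0..<k}"
  shows "det (minor_mat A k f g) = 0"
proof -
  from assms obtain i j where ij: "i < k" "j < k" "i \<noteq> j" "g i = g j"
    by (auto simp: inj_on_def)
  show ?thesis
    by (rule det_identical_columns[OF minor_mat_carrier ij(3,1,2)])
      (rule eq_vecI, use ij in auto)
qed

lemma minor_mat_cong:
  assumes "\<And>i. i < k \<Longrightarrow> f i = f' i" "\<And>i. i < k \<Longrightarrow> g i = g' i"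
  shows "minor_mat A k f g = minor_mat A k f' g'"
  using assms by (intro eq_matI) auto

text \<open>\<open>f\<close> and the increasing enumeration of its image list the same set; the
  permutation takes \<open>i\<close> to the rank of \<open>f i\<close>, the number of smaller image
  elements.\<close>

lemma pick_enumeration:
  assumes inj: "inj_on f {0..<k}"
  obtains p where "p permutes {0..<k}" "\<And>i. i < k \<Longrightarrow> pick (f ` {0..<k}) (p i) = f i"
proof
  define I where "I = f ` {0..<k}"
  define q where "q i = (if i < k then card {a \<in> I. a < f i} else i)" for i
  have fin: "finite I" and cI: "card I = k" by (auto simp: I_def card_image[OF inj])
  have pq: "pick I (q i) = f i" if "i < k" for i
    using that by (auto simp: q_def I_def intro!: pick_card_in_set)
  have "q i < k" if "i < k" for i
  proof -
    have "{a \<in> I. a < f i} \<subset> I" using that by (auto simp: I_def)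
    from psubset_card_mono[OF fin this] show ?thesis using that cI by (simp add: q_def)
  qed
  then have img: "q ` {0..<k} \<subseteq> {0..<k}" by auto
  have "inj_on q {0..<k}"
    by (rule inj_onI) (metis atLeastLessThan_iff inj inj_onD pq)
  then have "bij_betw q {0..<k} {0..<k}"
    using img by (simp add: bij_betw_def endo_inj_surj)
  then show "q permutes {0..<k}"
    by (rule bij_imp_permutes) (auto simp: q_def)
  show "pick (f ` {0..<k}) (q i) = f i" if "i < k" for i
    using pq[OF that] by (simp add: I_def)
qed

lemma submatrix_eq_minor_mat:
  assumes "I \<subseteq> {..<dim_row A}" "J \<subseteq> {..<dim_col A}" "card I = card J"
  shows "submatrix A I J = minor_mat A (card I) (pick I) (pick J)"
proof -
  have "{i. i < dim_row A \<and> i \<in> I} = I" "{j. j < dim_col A \<and> j \<in> J} = J"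
    using assms by auto
  then show ?thesis using assms by (simp add: submatrix_def minor_mat_def)
qed

text \<open>Sorting the selected rows and columns multiplies the determinant by two signs. The
  ambiguity does no harm later, as orders ignore signs.\<close>

lemma det_minor_eq_submatrix:
  fixes A :: "'a::comm_ring_1 mat"
  assumes f: "inj_on f {0..<k}" "f ` {0..<k} \<subseteq> {..<dim_row A}"
    and g: "inj_on g {0..<k}" "g ` {0..<k} \<subseteq> {..<dim_col A}"
  shows "det (submatrix A (f ` {0..<k}) (g ` {0..<k})) \<in> {det (minor_mat A k f g), - det (minor_mat A k f g)}"
proof -
  define I J where "I = f ` {0..<k}" and "J = g ` {0..<k}"
  obtain p where p: "p permutes {0..<k}" "\<And>i. i < k \<Longrightarrow> pick I (p i) = f i"
    using pick_enumeration[OF f(1)] by (metis I_def)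
  obtain q where q: "q permutes {0..<k}" "\<And>i. i < k \<Longrightarrow> pick J (q i) = g i"
    using pick_enumeration[OF g(1)] by (metis J_def)
  have c: "card I = k" "card J = k" by (auto simp: I_def J_def card_image f g)
  have "minor_mat A k f g = minor_mat A k (pick I \<circ> p) (pick J \<circ> q)"
    by (rule minor_mat_cong) (auto simp: p q)
  then have "det (minor_mat A k f g) = signof p * (signof q * det (minor_mat A k (pick I) (pick J)))"
    by (simp add: det_minor_permute_rows p det_minor_permute_cols q)
  also have "minor_mat A k (pick I) (pick J) = submatrix A I J"
    using submatrix_eq_minor_mat[of I A J] f g c by (simp add: I_def J_def)
  finally have *: "det (minor_mat A k f g) = signof p * (signof q * det (submatrix A I J))" .
  show ?thesis
    unfolding I_def[symmetric] J_def[symmetric] * by (simp add: sign_def)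
qed

section \<open>Minors of a product: the Cauchy-Binet formula\<close>

text \<open>Each row of the product is a combination of rows of \<open>B\<close>, and the
  determinant is linear in each row. The maps in \<open>H\<close> are pinned to the identity off
  \<open>{0..<k}\<close>, which makes \<open>H\<close> finite.\<close>

lemma det_minor_mult_expand:
  fixes A B :: "'a::comm_ring_1 mat"
  assumes A: "A \<in> carrier_mat m n" and B: "B \<in> carrier_mat n l"
    and f: "f ` {0..<k} \<subseteq> {0..<m}" and g: "g ` {0..<k} \<subseteq> {0..<l}"
  defines "H \<equiv> {h. (\<forall>i\<in>{0..<k}. h i \<in> {0..<n}) \<and> (\<forall>i. i \<notin> {0..<k} \<longrightarrow> h i = i)}"
  shows "det (minor_mat (A * B) k f g)
    = (\<Sum>h\<in>H. (\<Prod>i=0..<k. A $$ (f i, h i)) * det (minor_mat B k h g))"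
proof -
  define a where "a i s = vec k (\<lambda>j. A $$ (f i, s) * B $$ (s, g j))" for i s
  have a: "a \<in> {0..<k} \<rightarrow> {0..<n} \<rightarrow> carrier_vec k" by (auto simp: a_def)
  have fin: "finsum_vec TYPE('a) k (a i) {0..<n} = vec k (\<lambda>j. \<Sum>s=0..<n. A $$ (f i, s) * B $$ (s, g j))"
    if "i < k" for i
  proof -
    have "finsum_vec TYPE('a) k (a i) {0..<n} $ j = (\<Sum>s=0..<n. A $$ (f i, s) * B $$ (s, g j))" if "j < k" for j
      using that by (subst index_finsum_vec) (auto simp: a_def)
    moreover have "finsum_vec TYPE('a) k (a i) {0..<n} \<in> carrier_vec k"
      by (rule finsum_vec_closed) (auto simp: a_def)
    ultimately show ?thesis by (intro eq_vecI) auto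
  qed
  have "minor_mat (A * B) k f g = mat\<^sub>r k k (\<lambda>i. finsum_vec TYPE('a) k (a i) {0..<n})"
    using A B f g by (intro eq_matI) (auto simp: fin scalar_prod_def image_subset_iff)
  also have "det \<dots> = (\<Sum>h\<in>H. det (mat\<^sub>r k k (\<lambda>i. a i (h i))))"
    unfolding H_def by (rule det_linear_rows_sum[OF _ a]) simp
  also have "\<dots> = (\<Sum>h\<in>H. (\<Prod>i=0..<k. A $$ (f i, h i)) * det (minor_mat B k h g))"
  proof (rule sum.cong[OF refl])
    fix h
    have "mat\<^sub>r k k (\<lambda>i. a i (h i)) = mat\<^sub>r k k (\<lambda>i. A $$ (f i, h i) \<cdot>\<^sub>v row (minor_mat B k h g) i)"
      by (rule eq_matI) (auto simp: a_def)
    then have "det (mat\<^sub>r k k (\<lambda>i. a i (h i))) =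
        (\<Prod>i=0..<k. A $$ (f i, h i)) * det (mat\<^sub>r k k (\<lambda>i. row (minor_mat B k h g) i))"
      using det_rows_mul[of "\<lambda>i. row (minor_mat B k h g) i" k "\<lambda>i. A $$ (f i, h i)"] by auto
    also have "mat\<^sub>r k k (\<lambda>i. row (minor_mat B k h g) i) = minor_mat B k h g"
      by (rule eq_matI) auto
    finally show "det (mat\<^sub>r k k (\<lambda>i. a i (h i))) = (\<Prod>i=0..<k. A $$ (f i, h i)) * det (minor_mat B k h g)" .
  qed
  finally show ?thesis .
qed

text \<open>Summing over all maps rather than over increasing ones counts each minor \<open>fact k\<close> times.\<close>

lemma cauchy_binet_fact:
  fixes A B :: "'a::comm_ring_1 mat"
  assumes A: "A \<in> carrier_mat m n" and B: "B \<in> carrier_mat n l"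
    and f: "f ` {0..<k} \<subseteq> {0..<m}" and g: "g ` {0..<k} \<subseteq> {0..<l}"
  defines "H \<equiv> {h. (\<forall>i\<in>{0..<k}. h i \<in> {0..<n}) \<and> (\<forall>i. i \<notin> {0..<k} \<longrightarrow> h i = i)}"
  shows "of_nat (fact k) * det (minor_mat (A * B) k f g)
    = (\<Sum>h\<in>H. det (minor_mat A k f h) * det (minor_mat B k h g))"
proof -
  let ?P = "{p. p permutes {0..<k}}"
  \<comment> \<open>\<open>p\<close> permutes \<open>{0..<k}\<close> and fixes every other index, so
    composing with it preserves both conditions in \<open>H\<close>.\<close>
  have bij: "bij_betw (\<lambda>h. h \<circ> p) H H" if p: "p permutes {0..<k}" for p
  proof (rule bij_betw_byWitness[where f' = "\<lambda>h. h \<circ> inv_into UNIV p"])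
    note ps = permutes_in_image[OF p] permutes_in_image[OF permutes_inv[OF p]]
      permutes_not_in[OF p] permutes_not_in[OF permutes_inv[OF p]]
    show "\<forall>h\<in>H. (h \<circ> p) \<circ> inv_into UNIV p = h" "\<forall>h\<in>H. (h \<circ> inv_into UNIV p) \<circ> p = h"
      by (simp_all add: o_assoc[symmetric] permutes_inv_o[OF p])
    show "(\<lambda>h. h \<circ> p) ` H \<subseteq> H" "(\<lambda>h. h \<circ> inv_into UNIV p) ` H \<subseteq> H"
      using ps by (auto simp: H_def)
  qed
  have "(\<Sum>h\<in>H. det (minor_mat A k f h) * det (minor_mat B k h g))
    = (\<Sum>h\<in>H. \<Sum>p\<in>?P. (\<Prod>i=0..<k. A $$ (f i, (h \<circ> p) i)) * det (minor_mat B k (h \<circ> p) g))"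
  proof (rule sum.cong[OF refl])
    fix h
    \<comment> \<open>Leibniz expansion of the minor of \<open>A\<close>; the sign of
      \<open>p\<close> is absorbed by permuting the rows of the minor of \<open>B\<close>.\<close>
    have "det (minor_mat A k f h) * det (minor_mat B k h g)
      = (\<Sum>p\<in>?P. signof p * (\<Prod>i=0..<k. A $$ (f i, h (p i))) * det (minor_mat B k h g))"
      unfolding det_def'[OF minor_mat_carrier[of A]] sum_distrib_right
      by (rule sum.cong[OF refl]) (auto intro!: prod.cong simp: permutes_in_image[of _ "{0..<k}", simplified])
    also have "\<dots> = (\<Sum>p\<in>?P. (\<Prod>i=0..<k. A $$ (f i, (h \<circ> p) i)) * det (minor_mat B k (h \<circ> p) g))"
      by (rule sum.cong[OF refl]) (simp add: det_minor_permute_rows mult_ac)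
    finally show "det (minor_mat A k f h) * det (minor_mat B k h g) = \<dots>" .
  qed
  also have "\<dots> = (\<Sum>p\<in>?P. \<Sum>h\<in>H. (\<Prod>i=0..<k. A $$ (f i, (h \<circ> p) i)) * det (minor_mat B k (h \<circ> p) g))"
    by (rule sum.swap)
  \<comment> \<open>Each \<open>p\<close> merely reindexes \<open>H\<close>, so every inner sum is
    the full expansion of the minor of the product.\<close>
  also have "\<dots> = (\<Sum>p\<in>?P. det (minor_mat (A * B) k f g))"
  proof (rule sum.cong[OF refl])
    fix p assume "p \<in> ?P"
    then have "bij_betw (\<lambda>h. h \<circ> p) H H" using bij by simp
    from sum.reindex_bij_betw[OF this, of "\<lambda>h. (\<Prod>i=0..<k. A $$ (f i, h i)) * det (minor_mat B k h g)"]
    show "(\<Sum>h\<in>H. (\<Prod>i=0..<k. A $$ (f i, (h \<circ> p) i)) * det (minor_mat B k (h \<circ> p) g))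
      = det (minor_mat (A * B) k f g)"
      unfolding det_minor_mult_expand[OF A B f g] H_def by simp
  qed
  also have "\<dots> = of_nat (fact k) * det (minor_mat (A * B) k f g)"
    by (simp add: card_permutations[OF refl])
  finally show ?thesis by simp
qed

section \<open>Jacobi's complementary minor theorem\<close>

text \<open>The complement of the image has as many elements as \<open>{k..<n}\<close>, so a
  bijection between these two sets completes \<open>f\<close>. The permutation serves to move
  selected rows or columns to the front.\<close>

lemma inj_extends_to_permutation:
  fixes f :: "nat \<Rightarrow> nat"
  assumes inj: "inj_on f {0..<k}" and img: "f ` {0..<k} \<subseteq> {0..<n}"
  obtains p where "p permutes {0..<n}" "\<And>i. i < k \<Longrightarrow> p i = f i"
proof -
  have kn: "k \<le> n" using card_mono[OF _ img] card_image[OF inj] by simp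
  have "card ({0..<n} - f ` {0..<k}) = card {k..<n}"
    using img by (simp add: card_Diff_subset card_image[OF inj])
  then obtain g where g: "bij_betw g {k..<n} ({0..<n} - f ` {0..<k})"
    by (metis bij_betw_iff_card finite_Diff finite_atLeastLessThan)
  define p where "p i = (if i < k then f i else if i < n then g i else i)" for i
  have "bij_betw p {0..<k} (f ` {0..<k})"
    using inj by (simp add: p_def bij_betw_def inj_on_def)
  moreover have "bij_betw p {k..<n} ({0..<n} - f ` {0..<k})"
    using g by (subst bij_betw_cong[where g = g]) (auto simp: p_def)
  ultimately have "bij_betw p ({0..<k} \<union> {k..<n}) (f ` {0..<k} \<union> ({0..<n} - f ` {0..<k}))"
    by (rule bij_betw_combine) auto
  moreover have "{0..<k} \<union> {k..<n} = {0..<n}" "f ` {0..<k} \<union> ({0..<n} - f ` {0..<k}) = {0..<n}"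
    using kn img by auto
  ultimately have "bij_betw p {0..<n} {0..<n}" by simp
  then have "p permutes {0..<n}"
    by (rule bij_imp_permutes) (use kn in \<open>auto simp: p_def\<close>)
  then show ?thesis by (rule that) (simp add: p_def)
qed

text \<open>Take determinants in
  \<open>[[A11, A12], [A21, A22]] * [[B11, 0], [B21, 1]] = [[1, A12], [0, A22]]\<close>.\<close>

lemma jacobi_complementary_minor:
  fixes A B :: "'a::field mat"
  assumes A: "A \<in> carrier_mat n n" and B: "B \<in> carrier_mat n n" and AB: "A * B = 1\<^sub>m n"
    and f: "inj_on f {0..<k}" "f ` {0..<k} \<subseteq> {0..<n}"
    and g: "inj_on g {0..<k}" "g ` {0..<k} \<subseteq> {0..<n}"
  obtains l f' g' where "f' ` {0..<l} \<subseteq> {0..<n}" "g' ` {0..<l} \<subseteq> {0..<n}"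
    "det (minor_mat A l f' g') \<in> {det A * det (minor_mat B k f g), - (det A * det (minor_mat B k f g))}"
proof -
  obtain p where p: "p permutes {0..<n}" "\<And>i. i < k \<Longrightarrow> p i = f i"
    using inj_extends_to_permutation[OF f] by metis
  obtain q where q: "q permutes {0..<n}" "\<And>i. i < k \<Longrightarrow> q i = g i"
    using inj_extends_to_permutation[OF g] by metis
  have pn [simp]: "p i < n \<longleftrightarrow> i < n" for i using permutes_in_image[OF p(1), of i] by simp
  have qn [simp]: "q i < n \<longleftrightarrow> i < n" for i using permutes_in_image[OF q(1), of i] by simp
  have kn: "k \<le> n" using card_mono[OF _ f(2)] card_image[OF f(1)] by simp
  \<comment> \<open>Rows of \<open>A\<close> are ordered by \<open>q\<close> and columns by
    \<open>p\<close>, opposite to \<open>B\<close>, so that the reordered matrices are still inverse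
    to each other. \<open>X\<close> keeps the first \<open>k\<close> columns of the reordered
    \<open>B\<close> and takes the others from the identity.\<close>
  define A' where "A' = minor_mat A n q p"
  define X where "X = mat n n (\<lambda>(i, j). if j < k then B $$ (p i, q j) else if i = j then 1 else 0)"
  define Y where "Y = mat n n (\<lambda>(i, j). if j < k then if i = j then 1 else 0 else A $$ (q i, p j))"
  have A': "A' \<in> carrier_mat n n" and X: "X \<in> carrier_mat n n" by (simp_all add: A'_def X_def)
  have "minor_mat A n q p = minor_mat A n (id \<circ> q) (id \<circ> p)" by simp
  then have "det A' = signof q * (signof p * det (minor_mat A n id id))"
    unfolding A'_def by (simp only: det_minor_permute_rows[OF q(1)] det_minor_permute_cols[OF p(1)] mult.left_commute)
  moreover have "minor_mat A n id id = A" using A by (intro eq_matI) auto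
  ultimately have detA': "det A' \<in> {det A, - det A}" by (simp add: sign_def)
  have "A' * X = Y"
  proof (rule eq_matI)
    fix i j assume "i < dim_row Y" "j < dim_col Y"
    then have ij: "i < n" "j < n" by (simp_all add: Y_def)
    have "(A' * X) $$ (i, j) = (\<Sum>s=0..<n. A $$ (q i, p s) * X $$ (s, j))"
      using ij A' X by (simp add: scalar_prod_def A'_def)
    also have "\<dots> = Y $$ (i, j)"
    proof (cases "j < k")
      case True
      have "(\<Sum>s=0..<n. A $$ (q i, p s) * X $$ (s, j)) = (\<Sum>s=0..<n. A $$ (q i, p s) * B $$ (p s, q j))"
        using True ij by (intro sum.cong) (auto simp: X_def)
      also have "\<dots> = (\<Sum>s=0..<n. A $$ (q i, s) * B $$ (s, q j))"
        using sum.permute[OF p(1), of "\<lambda>s. A $$ (q i, s) * B $$ (s, q j)"] by (simp add: o_def)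
      also have "\<dots> = (A * B) $$ (q i, q j)" using ij A B by (simp add: scalar_prod_def)
      also have "\<dots> = (if i = j then 1 else 0)"
        using ij by (auto simp: AB dest: permutes_inj[OF q(1), THEN injD])
      finally show ?thesis using True ij by (simp add: Y_def)
    next
      case False
      then have "(\<Sum>s=0..<n. A $$ (q i, p s) * X $$ (s, j)) = (\<Sum>s=0..<n. if s = j then A $$ (q i, p s) else 0)"
        using ij by (intro sum.cong) (auto simp: X_def)
      then show ?thesis using False ij by (simp add: Y_def)
    qed
    finally show "(A' * X) $$ (i, j) = Y $$ (i, j)" .
  qed (auto simp: A'_def X_def Y_def)
  then have det: "det A' * det X = det Y" using det_mult[OF A' X] by simp
  have "X = four_block_mat (minor_mat B k f g) (0\<^sub>m k (n - k))
      (mat (n - k) k (\<lambda>(i, j). B $$ (p (k + i), q j))) (1\<^sub>m (n - k))"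
    using kn by (intro eq_matI) (auto simp: X_def p q)
  then have "det X = det (minor_mat B k f g)"
    by (simp add: det_four_block_mat_upper_right_zero[where n = k and m = "n - k"])
  moreover have "Y = four_block_mat (1\<^sub>m k) (mat k (n - k) (\<lambda>(i, j). A $$ (q i, p (k + j))))
      (0\<^sub>m (n - k) k) (minor_mat A (n - k) (\<lambda>i. q (k + i)) (\<lambda>j. p (k + j)))"
    using kn by (intro eq_matI) (auto simp: Y_def)
  then have "det Y = det (minor_mat A (n - k) (\<lambda>i. q (k + i)) (\<lambda>j. p (k + j)))"
    by (simp add: det_four_block_mat_lower_left_zero[where n = k and m = "n - k"])
  ultimately show ?thesis
    using det detA' by (intro that[of "\<lambda>i. q (k + i)" "n - k" "\<lambda>j. p (k + j)"]) (auto simp: image_subset_iff)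
qed

section \<open>Evaluation of rational functions\<close>

text \<open>At a zero of the reduced denominator \<open>rat_eval\<close> returns the default value
  of division by 0, and the laws of evaluation can fail there.\<close>

definition regular_at :: "(real \<Rightarrow> 'a::field) \<Rightarrow> ratfun \<Rightarrow> 'a \<Rightarrow> bool" where
  "regular_at h f x \<longleftrightarrow> poly (map_poly h (snd (quot_of_fract f))) x \<noteq> 0"

lemma ratfun_quot:
  "f = to_fract (fst (quot_of_fract f)) / to_fract (snd (quot_of_fract f))"
  by (metis Fract_conv_to_fract Fract_quot_of_fract)

text \<open>The reduced denominator divides every other denominator \<open>q\<close>, so it cannot
  vanish where \<open>q\<close> does not; the two values then agree by cross multiplication.\<close>

lemma rat_eval_frac:
  assumes h: "field_hom h" and q: "poly (map_poly h q) x \<noteq> 0"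
  shows "regular_at h (to_fract p / to_fract q) x"
    and "rat_eval h (to_fract p / to_fract q) x = poly (map_poly h p) x / poly (map_poly h q) x"
proof -
  interpret field_hom h by (rule h)
  interpret hp: map_poly_idom_hom h ..
  define f where "f = to_fract p / to_fract q"
  define a b where "a = fst (quot_of_fract f)" and "b = snd (quot_of_fract f)"
  have b: "b \<noteq> 0" by (simp add: b_def)
  have q0: "q \<noteq> 0" using q by auto
  have "to_fract a / to_fract b = to_fract p / to_fract q"
    using ratfun_quot[of f] by (simp add: a_def b_def f_def)
  then have "to_fract (a * q) = to_fract (p * b)" using b q0 by (simp add: frac_eq_eq)
  then have eq: "a * q = p * b" by (simp only: to_fract_eq_iff)
  have "coprime a b" by (simp add: a_def b_def coprime_quot_of_fract)
  moreover have "b dvd a * q" by (simp add: eq)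
  ultimately have "b dvd q" by (simp add: coprime_commute coprime_dvd_mult_right_iff)
  then obtain c where "q = b * c" by (elim dvdE)
  then have bx: "poly (map_poly h b) x \<noteq> 0" using q by (simp add: hp.hom_mult)
  then show "regular_at h (to_fract p / to_fract q) x"
    by (simp add: regular_at_def b_def f_def)
  have "poly (map_poly h (a * q)) x = poly (map_poly h (p * b)) x" by (simp add: eq)
  then have "poly (map_poly h a) x / poly (map_poly h b) x = poly (map_poly h p) x / poly (map_poly h q) x"
    using bx q by (simp add: hp.hom_mult frac_eq_eq)
  then show "rat_eval h (to_fract p / to_fract q) x = poly (map_poly h p) x / poly (map_poly h q) x"
    by (simp add: rat_eval_def case_prod_unfold a_def b_def f_def)
qed

lemma
  assumes h: "field_hom h" and f: "regular_at h f x" and g: "regular_at h g x"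
  shows regular_at_add: "regular_at h (f + g) x"
    and rat_eval_add: "rat_eval h (f + g) x = rat_eval h f x + rat_eval h g x"
    and regular_at_mult: "regular_at h (f * g) x"
    and rat_eval_mult: "rat_eval h (f * g) x = rat_eval h f x * rat_eval h g x"
proof -
  interpret field_hom h by (rule h)
  interpret hp: map_poly_idom_hom h ..
  define a b where "a = fst (quot_of_fract f)" and "b = snd (quot_of_fract f)"
  define c d where "c = fst (quot_of_fract g)" and "d = snd (quot_of_fract g)"
  have ab: "f = to_fract a / to_fract b" and cd: "g = to_fract c / to_fract d"
    unfolding a_def b_def c_def d_def by (rule ratfun_quot)+
  have b: "b \<noteq> 0" and d: "d \<noteq> 0" by (simp_all add: b_def d_def)
  have bx: "poly (map_poly h b) x \<noteq> 0" and dx: "poly (map_poly h d) x \<noteq> 0"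
    using f g by (simp_all add: regular_at_def b_def d_def)
  have bd: "poly (map_poly h (b * d)) x \<noteq> 0" using bx dx by (simp add: hp.hom_mult)
  have add: "f + g = to_fract (a * d + c * b) / to_fract (b * d)"
    using b d by (simp add: ab cd add_frac_eq)
  have mult: "f * g = to_fract (a * c) / to_fract (b * d)"
    by (simp add: ab cd)
  have fg: "rat_eval h f x = poly (map_poly h a) x / poly (map_poly h b) x"
    "rat_eval h g x = poly (map_poly h c) x / poly (map_poly h d) x"
    unfolding ab cd by (rule rat_eval_frac(2)[OF h bx] rat_eval_frac(2)[OF h dx])+
  show "regular_at h (f + g) x" "regular_at h (f * g) x"
    unfolding add mult by (rule rat_eval_frac(1)[OF h bd])+
  show "rat_eval h (f + g) x = rat_eval h f x + rat_eval h g x"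
    unfolding fg unfolding add rat_eval_frac(2)[OF h bd]
    using bx dx by (simp add: hp.hom_mult hp.hom_add add_frac_eq)
  show "rat_eval h (f * g) x = rat_eval h f x * rat_eval h g x"
    unfolding fg unfolding mult rat_eval_frac(2)[OF h bd] by (simp add: hp.hom_mult)
qed

lemma rat_eval_to_fract:
  assumes h: "field_hom h"
  shows "regular_at h (to_fract p) x" "rat_eval h (to_fract p) x = poly (map_poly h p) x"
proof -
  interpret field_hom h by (rule h)
  show "regular_at h (to_fract p) x" "rat_eval h (to_fract p) x = poly (map_poly h p) x"
    using rat_eval_frac[OF h, of 1 x p] by simp_all
qed

lemma rat_eval_sum:
  assumes h: "field_hom h" and S: "finite S" "\<And>s. s \<in> S \<Longrightarrow> regular_at h (f s) x"
  shows "rat_eval h (\<Sum>s\<in>S. f s) x = (\<Sum>s\<in>S. rat_eval h (f s) x)"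
proof -
  interpret field_hom h by (rule h)
  have "regular_at h (\<Sum>s\<in>S. f s) x \<and> rat_eval h (\<Sum>s\<in>S. f s) x = (\<Sum>s\<in>S. rat_eval h (f s) x)"
    using S
  proof (induction S rule: finite_induct)
    case empty
    then show ?case using rat_eval_to_fract[OF h, of 0 x] by simp
  next
    case (insert s S)
    then show ?case by (simp add: regular_at_add[OF h] rat_eval_add[OF h])
  qed
  then show ?thesis by simp
qed

section \<open>The substitution of \<open>1/z\<close> for \<open>z\<close>\<close>

abbreviation const_fun :: "real \<Rightarrow> ratfun" where
  "const_fun c \<equiv> to_fract [:c:]"

lemma field_hom_const_fun: "field_hom const_fun"
proof
  show "const_fun (x * y) = const_fun x * const_fun y" for x y
    by (metis mult_to_poly to_fract_mult)
  show "const_fun (x + y) = const_fun x + const_fun y" for x y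
    by (metis add_pCons add_0 to_fract_add)
  show "const_fun 1 = 1" by (simp flip: one_pCons)
qed simp

interpretation const_fun: field_hom const_fun by (rule field_hom_const_fun)
interpretation const_fun_poly: map_poly_inj_idom_hom const_fun ..

lemma zvar_nonzero [simp]: "zvar \<noteq> 0"
  by (simp add: zvar_def)

lemma poly_const_fun_zvar: "poly (map_poly const_fun p) zvar = to_fract p"
proof (induction p)
  case (pCons c p)
  have "to_fract (pCons c p) = to_fract ([:c:] + [:0, 1:] * p)" by simp
  then have "to_fract (pCons c p) = const_fun c + zvar * to_fract p"
    by (simp only: to_fract_add to_fract_mult zvar_def)
  then show ?case using pCons by (simp add: const_fun_poly.map_poly_pCons_hom)
qed simp

lemma poly_const_fun_inverse_zvar:
  "poly (map_poly const_fun p) (1 / zvar) = to_fract (reflect_poly p) / zvar ^ degree p"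
proof -
  have "map_poly const_fun (reflect_poly p) = reflect_poly (map_poly const_fun p)"
    by (rule poly_eqI) (simp add: coeff_reflect_poly)
  then have "to_fract (reflect_poly p) = zvar ^ degree p * poly (map_poly const_fun p) (1 / zvar)"
    using poly_reflect_poly_nz[OF zvar_nonzero, of "map_poly const_fun p"] poly_const_fun_zvar[of "reflect_poly p"]
    by (simp add: inverse_eq_divide)
  then show ?thesis by (simp add: field_simps)
qed

text \<open>The denominator at \<open>1/z\<close> is a reversed nonzero polynomial over a power of
  \<open>z\<close>, hence nonzero: this is the transcendence of \<open>1/z\<close>.\<close>

lemma regular_at_inverse_zvar: "regular_at const_fun f (1 / zvar)"
  by (simp add: regular_at_def poly_const_fun_inverse_zvar)

lemma rat_reflect_to_fract: "rat_reflect (to_fract p) = to_fract (reflect_poly p) / zvar ^ degree p"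
  by (simp add: rat_reflect_def rat_eval_to_fract[OF field_hom_const_fun] poly_const_fun_inverse_zvar)

text \<open>The laws of evaluation hold unconditionally at \<open>1/z\<close>, because every
  rational function is regular at this point.\<close>

lemma field_hom_rat_reflect: "field_hom rat_reflect"
proof
  note h = field_hom_const_fun and r = regular_at_inverse_zvar
  show "rat_reflect (x + y) = rat_reflect x + rat_reflect y" for x y
    unfolding rat_reflect_def by (rule rat_eval_add[OF h r r])
  show "rat_reflect (x * y) = rat_reflect x * rat_reflect y" for x y
    unfolding rat_reflect_def by (rule rat_eval_mult[OF h r r])
  show "rat_reflect 0 = 0" using rat_reflect_to_fract[of 0] by simp
  show "rat_reflect 1 = 1" using rat_reflect_to_fract[of 1] by simp
qed

interpretation rat_reflect: field_hom rat_reflect by (rule field_hom_rat_reflect)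

lemma rat_reflect_zvar: "rat_reflect zvar = 1 / zvar"
proof -
  have "reflect_poly [:0, 1::real:] = 1" by (simp add: reflect_poly_def one_pCons)
  then show ?thesis using rat_reflect_to_fract[of "[:0, 1:]"] by (simp add: zvar_def)
qed

text \<open>A field homomorphism that fixes the constants commutes with evaluating real polynomials,
  and this one exchanges \<open>z\<close> and \<open>1/z\<close>.\<close>

lemma rat_reflect_involutive [simp]: "rat_reflect (rat_reflect f) = f"
proof -
  have c: "rat_reflect (const_fun c) = const_fun c" for c
    by (simp add: rat_reflect_to_fract)
  have "rat_reflect (poly (map_poly const_fun p) x) = poly (map_poly const_fun p) (rat_reflect x)" for p x
    by (induction p) (simp_all add: rat_reflect.hom_add rat_reflect.hom_mult c const_fun_poly.map_poly_pCons_hom)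
  from this[of _ "1 / zvar"] have p: "rat_reflect (rat_reflect (to_fract p)) = to_fract p" for p
    by (simp add: rat_reflect_to_fract poly_const_fun_inverse_zvar rat_reflect.hom_div rat_reflect_zvar poly_const_fun_zvar)
  show ?thesis
    by (subst (1 2) ratfun_quot) (simp add: rat_reflect.hom_div p)
qed

section \<open>Orders of rational functions\<close>

text \<open>The discrete valuation at a point of the Riemann sphere; \<open>z\<close> has a simple
  pole at infinity, hence minus the degree. The value at the zero polynomial carries no
  meaning.\<close>

fun poly_val :: "ext_complex \<Rightarrow> real poly \<Rightarrow> int" where
  "poly_val (Finite a) p = int (Polynomial.order a (map_poly complex_of_real p))"
| "poly_val Infinity p = - int (degree p)"

definition rat_val :: "ext_complex \<Rightarrow> ratfun \<Rightarrow> int" where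
  "rat_val \<alpha> f = poly_val \<alpha> (fst (quot_of_fract f)) - poly_val \<alpha> (snd (quot_of_fract f))"

interpretation complex_poly: map_poly_inj_idom_hom complex_of_real ..

lemma poly_val_mult: "p \<noteq> 0 \<Longrightarrow> q \<noteq> 0 \<Longrightarrow> poly_val \<alpha> (p * q) = poly_val \<alpha> p + poly_val \<alpha> q"
  by (cases \<alpha>) (simp_all add: complex_poly.hom_mult order_mult degree_mult_eq)

lemma poly_val_add:
  assumes "p \<noteq> 0" "q \<noteq> 0" "p + q \<noteq> 0" "k \<le> poly_val \<alpha> p" "k \<le> poly_val \<alpha> q"
  shows "k \<le> poly_val \<alpha> (p + q)"
proof (cases \<alpha>)
  case (Finite a)
  \<comment> \<open>A negative \<open>k\<close> becomes \<open>nat k = 0\<close>, for which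
    divisibility is trivial.\<close>
  have "[:-a, 1:] ^ nat k dvd map_poly complex_of_real p" "[:-a, 1:] ^ nat k dvd map_poly complex_of_real q"
    using assms by (simp_all add: order_divides Finite)
  then have "[:-a, 1:] ^ nat k dvd map_poly complex_of_real (p + q)"
    by (simp add: complex_poly.hom_add)
  moreover have "map_poly complex_of_real (p + q) \<noteq> 0"
    using assms(3) by (simp only: complex_poly.hom_0_iff simp_thms)
  ultimately show ?thesis by (simp add: order_divides Finite)
next
  case Infinity
  then show ?thesis using assms degree_add_le_max[of p q] by simp
qed

text \<open>Cross multiplication with the reduced fraction and additivity of \<open>poly_val\<close>
  make the order independent of the representation.\<close>

lemma rat_val_frac:
  assumes "p \<noteq> 0" "q \<noteq> 0"
  shows "rat_val \<alpha> (to_fract p / to_fract q) = poly_val \<alpha> p - poly_val \<alpha> q"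
proof -
  define f where "f = to_fract p / to_fract q"
  define a b where "a = fst (quot_of_fract f)" and "b = snd (quot_of_fract f)"
  have "f \<noteq> 0" using assms by (simp add: f_def)
  then have ab: "a \<noteq> 0" "b \<noteq> 0" by (simp_all add: a_def b_def)
  have "to_fract a / to_fract b = to_fract p / to_fract q"
    using ratfun_quot[of f] by (simp add: a_def b_def f_def)
  then have "to_fract (a * q) = to_fract (p * b)" using ab assms by (simp add: frac_eq_eq)
  then have "a * q = p * b" by (simp only: to_fract_eq_iff)
  then have "poly_val \<alpha> a + poly_val \<alpha> q = poly_val \<alpha> p + poly_val \<alpha> b"
    using ab assms by (metis poly_val_mult)
  then show ?thesis by (simp add: rat_val_def f_def a_def b_def)
qed

lemma nonzero_ratfunE:
  assumes "f \<noteq> (0::ratfun)"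
  obtains p q where "p \<noteq> 0" "q \<noteq> 0" "f = to_fract p / to_fract q"
  using assms ratfun_quot[of f] by (metis fst_quot_of_fract_eq_0_iff snd_quot_of_fract_nonzero)

lemma rat_val_mult:
  assumes "f \<noteq> 0" "g \<noteq> 0"
  shows "rat_val \<alpha> (f * g) = rat_val \<alpha> f + rat_val \<alpha> g"
proof -
  obtain p q where f: "p \<noteq> 0" "q \<noteq> 0" "f = to_fract p / to_fract q"
    using nonzero_ratfunE[OF assms(1)] .
  obtain p' q' where g: "p' \<noteq> 0" "q' \<noteq> 0" "g = to_fract p' / to_fract q'"
    using nonzero_ratfunE[OF assms(2)] .
  have "f * g = to_fract (p * p') / to_fract (q * q')" by (simp add: f g)
  then have "rat_val \<alpha> (f * g) = poly_val \<alpha> (p * p') - poly_val \<alpha> (q * q')"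
    using rat_val_frac[of "p * p'" "q * q'"] f g by simp
  then show ?thesis using f g by (simp add: rat_val_frac poly_val_mult)
qed

text \<open>The order of \<open>0\<close> counts as infinite.\<close>

definition val_ge :: "ext_complex \<Rightarrow> int \<Rightarrow> ratfun \<Rightarrow> bool" where
  "val_ge \<alpha> k f \<longleftrightarrow> f = 0 \<or> k \<le> rat_val \<alpha> f"

lemma val_ge_0 [simp]: "val_ge \<alpha> k 0"
  by (simp add: val_ge_def)

lemma val_ge_mult: "val_ge \<alpha> k f \<Longrightarrow> val_ge \<alpha> l g \<Longrightarrow> val_ge \<alpha> (k + l) (f * g)"
  by (cases "f = 0 \<or> g = 0") (auto simp: val_ge_def rat_val_mult)

lemma val_ge_add:
  assumes "val_ge \<alpha> k f" "val_ge \<alpha> k g"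
  shows "val_ge \<alpha> k (f + g)"
proof (cases "f = 0 \<or> g = 0 \<or> f + g = 0")
  case True
  then show ?thesis using assms by (auto simp: val_ge_def)
next
  case False
  obtain p q where f: "p \<noteq> 0" "q \<noteq> 0" "f = to_fract p / to_fract q"
    using nonzero_ratfunE[of f] False by metis
  obtain p' q' where g: "p' \<noteq> 0" "q' \<noteq> 0" "g = to_fract p' / to_fract q'"
    using nonzero_ratfunE[of g] False by metis
  have fg: "f + g = to_fract (p * q' + p' * q) / to_fract (q * q')"
    using f g by (simp add: add_frac_eq)
  have n: "p * q' + p' * q \<noteq> 0" using False fg by (metis div_0 to_fract_0)
  have "k \<le> poly_val \<alpha> p - poly_val \<alpha> q" "k \<le> poly_val \<alpha> p' - poly_val \<alpha> q'"
    using assms False f g by (auto simp: val_ge_def rat_val_frac)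
  then have "k + poly_val \<alpha> q + poly_val \<alpha> q' \<le> poly_val \<alpha> (p * q' + p' * q)"
    using f g n by (intro poly_val_add) (auto simp: poly_val_mult)
  then show ?thesis
    unfolding fg val_ge_def using f g n by (subst rat_val_frac) (auto simp: poly_val_mult)
qed

lemma rat_val_const: "c \<noteq> 0 \<Longrightarrow> rat_val \<alpha> (const_fun c) = 0"
  using rat_val_frac[of "[:c:]" 1 \<alpha>]
  by (cases \<alpha>) (auto simp: complex_poly.map_poly_pCons_hom order_0I)

lemma rat_val_1 [simp]: "rat_val \<alpha> 1 = 0"
  using rat_val_const[of 1 \<alpha>] by simp

lemma rat_val_minus [simp]: "rat_val \<alpha> (- f) = rat_val \<alpha> f"
proof (cases "f = 0")
  case False
  have "- f = const_fun (- 1) * f" by (simp add: const_fun.hom_uminus)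
  then show ?thesis using False rat_val_const[of "-1" \<alpha>]
    by (metis add_0 const_fun.hom_0_iff rat_val_mult zero_neq_neg_one)
qed simp

lemma val_ge_minus [simp]: "val_ge \<alpha> k (- f) \<longleftrightarrow> val_ge \<alpha> k f"
  by (simp add: val_ge_def)

lemma val_ge_sum: "(\<And>s. s \<in> S \<Longrightarrow> val_ge \<alpha> k (f s)) \<Longrightarrow> val_ge \<alpha> k (\<Sum>s\<in>S. f s)"
  by (induction S rule: infinite_finite_induct) (auto intro: val_ge_add)

lemma val_ge_prod: "(\<And>s. s \<in> S \<Longrightarrow> val_ge \<alpha> 0 (f s)) \<Longrightarrow> val_ge \<alpha> 0 (\<Prod>s\<in>S. f s)"
proof (induction S rule: infinite_finite_induct)
  case (insert s S)
  then show ?case using val_ge_mult[of \<alpha> 0 "f s" 0] by auto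
qed (auto simp: val_ge_def)

text \<open>A positive integer is a nonzero constant, of order 0 everywhere. This cancels the
  factorial in the Cauchy-Binet formula.\<close>

lemma val_ge_of_nat_mult_iff:
  assumes "n > 0"
  shows "val_ge \<alpha> k (of_nat n * f) \<longleftrightarrow> val_ge \<alpha> k f"
proof -
  have n: "of_nat n = const_fun (real n)" by (induction n) (simp_all add: const_fun.hom_add)
  then have "of_nat n \<noteq> (0::ratfun)" using assms by (simp del: of_nat_eq_0_iff)
  moreover have "rat_val \<alpha> (of_nat n) = 0" using n rat_val_const assms by simp
  ultimately show ?thesis by (cases "f = 0") (auto simp: val_ge_def rat_val_mult)
qed

text \<open>A Bezout identity over the reals survives the embedding, so there is no common complex
  root.\<close>

lemma coprime_complex_polys:
  assumes "coprime p (q :: real poly)"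
  shows "poly (map_poly complex_of_real p) x \<noteq> 0 \<or> poly (map_poly complex_of_real q) x \<noteq> 0"
proof -
  obtain u v where "u * p + v * q = 1"
    using assms bezout_coefficients_fst_snd[of p q] by (metis coprime_iff_gcd_eq_1)
  then have "map_poly complex_of_real (u * p + v * q) = 1" by simp
  then have "poly (map_poly complex_of_real (u * p + v * q)) x = 1" by simp
  then show ?thesis by (auto simp: complex_poly.hom_mult complex_poly.hom_add)
qed

text \<open>At a finite point one of the reduced numerator and denominator has order 0, so the order
  of the denominator is the truncated negative order of \<open>f\<close>.\<close>

lemma pole_mult_eq: "pole_mult f \<alpha> = (if f = 0 then 0 else nat (- rat_val \<alpha> f))"
proof (cases "f = 0")
  case True
  then show ?thesis by (cases \<alpha>) auto
next
  case False
  define p q where "p = fst (quot_of_fract f)" and "q = snd (quot_of_fract f)"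
  have pq: "p \<noteq> 0" "q \<noteq> 0" "coprime p q"
    using False by (auto simp: p_def q_def coprime_quot_of_fract)
  show ?thesis
  proof (cases \<alpha>)
    case (Finite a)
    have "Polynomial.order a (map_poly complex_of_real p) = 0 \<or> Polynomial.order a (map_poly complex_of_real q) = 0"
      using coprime_complex_polys[OF pq(3), of a] by (auto simp: order_0I)
    then show ?thesis using False by (auto simp: Finite rat_val_def p_def q_def)
  qed (use False in \<open>auto simp: rat_val_def\<close>)
qed

lemma pole_mult_le_iff: "pole_mult f \<alpha> \<le> n \<longleftrightarrow> val_ge \<alpha> (- int n) f"
  by (auto simp: pole_mult_eq val_ge_def)

section \<open>Orders under inversion of the extended plane\<close>

fun ext_inverse :: "ext_complex \<Rightarrow> ext_complex" where
  "ext_inverse (Finite a) = (if a = 0 then Infinity else Finite (1 / a))"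
| "ext_inverse Infinity = Finite 0"

lemma ext_inverse_involutive [simp]: "ext_inverse (ext_inverse \<alpha>) = \<alpha>"
  by (cases \<alpha>) auto

text \<open>The left side is the order of \<open>p(1/z)\<close>, that is of the reversed polynomial
  over \<open>z ^ degree p\<close>. Reversal drops the factors \<open>z\<close>, which settles
  infinity; it gives a nonzero constant term, which settles 0; elsewhere it turns a factor
  \<open>z - 1/a\<close> into a nonzero multiple of \<open>z - a\<close>.\<close>

lemma poly_val_reflect:
  assumes p: "p \<noteq> 0"
  shows "poly_val \<alpha> (reflect_poly p) - int (degree p) * poly_val \<alpha> [:0, 1:] = poly_val (ext_inverse \<alpha>) p"
proof (cases \<alpha>)
  case Infinity
  obtain q where q: "map_poly complex_of_real p = [:-0, 1:] ^ Polynomial.order 0 (map_poly complex_of_real p) * q"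
      "\<not> [:-0, 1:] dvd q"
    using order_decomp[of "map_poly complex_of_real p" 0] p by auto
  define n where "n = Polynomial.order 0 (map_poly complex_of_real p)"
  have q0: "q \<noteq> 0" and "poly q 0 \<noteq> 0" using q(2) by (auto simp: poly_eq_0_iff_dvd)
  then have "coeff q 0 \<noteq> 0" by (simp add: poly_0_coeff_0)
  then have "degree (reflect_poly q) = degree q" by simp
  moreover have "reflect_poly [:0, 1::complex:] = 1" by (simp add: reflect_poly_def one_pCons)
  then have "reflect_poly (map_poly complex_of_real p) = reflect_poly q"
    by (subst q(1)) (simp add: reflect_poly_mult reflect_poly_power)
  moreover have "reflect_poly (map_poly complex_of_real p) = map_poly complex_of_real (reflect_poly p)"
    by (rule poly_eqI) (simp add: coeff_reflect_poly)
  ultimately have "degree (reflect_poly p) = degree q"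
    by (metis of_real_hom.degree_map_poly_hom)
  moreover have "degree (map_poly complex_of_real p) = n + degree q"
    using q0 by (subst q(1)) (simp add: degree_mult_eq degree_power_eq n_def)
  ultimately show ?thesis using Infinity by (simp add: n_def)
next
  case (Finite a)
  have refl: "map_poly complex_of_real (reflect_poly p) = reflect_poly (map_poly complex_of_real p)"
    by (rule poly_eqI) (simp add: coeff_reflect_poly)
  have z: "map_poly complex_of_real [:0, 1:] = [:0, 1:]" by (simp add: complex_poly.map_poly_pCons_hom)
  show ?thesis
  proof (cases "a = 0")
    case True
    have "Polynomial.order 0 (reflect_poly (map_poly complex_of_real p)) = 0"
      using p by (intro order_0I) simp
    moreover have "Polynomial.order 0 [:0, 1::complex:] = 1"
      using order_power_n_n[of "0::complex" 1] by simp
    ultimately show ?thesis using True Finite refl z by simp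
  next
    case False
    define n where "n = Polynomial.order (1 / a) (map_poly complex_of_real p)"
    obtain q where q: "map_poly complex_of_real p = [:- (1 / a), 1:] ^ n * q"
        "\<not> [:- (1 / a), 1:] dvd q"
      using order_decomp[of "map_poly complex_of_real p" "1 / a"] p by (auto simp: n_def)
    have q0: "q \<noteq> 0" and "poly q (1 / a) \<noteq> 0" using q(2) by (auto simp: poly_eq_0_iff_dvd)
    then have qa: "poly (reflect_poly q) a \<noteq> 0"
      using False by (simp add: poly_reflect_poly_nz inverse_eq_divide)
    have "reflect_poly [:- (1 / a), 1:] = [:1, - (1 / a):]"
      using False by (simp add: reflect_poly_def)
    also have "\<dots> = smult (- (1 / a)) [:- a, 1:]" using False by simp
    finally have "reflect_poly (map_poly complex_of_real p)
        = smult ((- (1 / a)) ^ n) ([:- a, 1:] ^ n * reflect_poly q)"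
      by (subst q(1)) (simp only: reflect_poly_mult reflect_poly_power smult_power mult_smult_left)
    then have "Polynomial.order a (reflect_poly (map_poly complex_of_real p)) = n"
      using False q0 qa by (simp add: order_smult order_mult order_power_n_n order_0I)
    moreover have "Polynomial.order a [:0, 1::complex:] = 0" using False by (intro order_0I) simp
    ultimately show ?thesis using Finite False refl z by (simp add: n_def)
  qed
qed

lemma rat_val_to_fract: "p \<noteq> 0 \<Longrightarrow> rat_val \<alpha> (to_fract p) = poly_val \<alpha> p"
  using rat_val_frac[of p 1 \<alpha>] by (cases \<alpha>) auto

lemma rat_val_power: "f \<noteq> 0 \<Longrightarrow> rat_val \<alpha> (f ^ n) = int n * rat_val \<alpha> f"
  by (induction n) (simp_all add: rat_val_mult algebra_simps)

lemma rat_val_divide: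
  assumes "f \<noteq> 0" "g \<noteq> 0"
  shows "rat_val \<alpha> (f / g) = rat_val \<alpha> f - rat_val \<alpha> g"
  using rat_val_mult[of "f / g" g \<alpha>] assms by simp

lemma rat_val_reflect:
  assumes "f \<noteq> 0"
  shows "rat_val \<alpha> (rat_reflect f) = rat_val (ext_inverse \<alpha>) f"
proof -
  have poly: "rat_val \<alpha> (rat_reflect (to_fract p)) = poly_val (ext_inverse \<alpha>) p" if "p \<noteq> 0" for p
    using that poly_val_reflect[of p \<alpha>]
    by (simp add: rat_reflect_to_fract rat_val_divide rat_val_power rat_val_to_fract zvar_def)
  obtain p q where f: "p \<noteq> 0" "q \<noteq> 0" "f = to_fract p / to_fract q"
    using nonzero_ratfunE[OF assms] .
  then show ?thesis by (simp add: rat_reflect.hom_div rat_val_divide poly rat_val_to_fract)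
qed

section \<open>Pole degrees of matrices\<close>

lemma pick_inj:
  assumes "pick S i = pick S j" "i < card S" "j < card S"
  shows "i = j"
  using assms card_pick by metis

text \<open>The minors in the definition of \<open>pole_degree\<close> select rows and columns along
  the injective maps \<open>pick I\<close> and \<open>pick J\<close>.\<close>

lemma pole_degree_leI:
  assumes "\<And>k f g. inj_on f {0..<k} \<Longrightarrow> inj_on g {0..<k} \<Longrightarrow> f ` {0..<k} \<subseteq> {0..<dim_row G} \<Longrightarrow>
    g ` {0..<k} \<subseteq> {0..<dim_col G} \<Longrightarrow> val_ge \<alpha> (- int n) (det (minor_mat G k f g))"
  shows "pole_degree G \<alpha> \<le> n"
proof -
  let ?D = "{(I, J). I \<subseteq> {..<dim_row G} \<and> J \<subseteq> {..<dim_col G} \<and> card I = card J}"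
  let ?M = "{pole_mult (det (submatrix G I J)) \<alpha> | I J.
            I \<subseteq> {..<dim_row G} \<and> J \<subseteq> {..<dim_col G} \<and> card I = card J}"
  have "finite ?D"
    by (rule finite_subset[of _ "Pow {..<dim_row G} \<times> Pow {..<dim_col G}"]) auto
  moreover have "?M = (\<lambda>(I, J). pole_mult (det (submatrix G I J)) \<alpha>) ` ?D" by auto
  ultimately have fin: "finite ?M" by simp
  have "pole_mult (det (submatrix G {} {})) \<alpha> \<in> ?M" by fastforce
  then have ne: "?M \<noteq> {}" by blast
  have "pole_mult (det (submatrix G I J)) \<alpha> \<le> n"
    if I: "I \<subseteq> {..<dim_row G}" and J: "J \<subseteq> {..<dim_col G}" and c: "card I = card J" for I J
  proof -
    have fI: "finite I" "finite J" using I J finite_subset by blast+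
    have p: "pick I i \<in> I" "pick J i \<in> J" if "i < card I" for i
      using that c by (simp_all add: pick_in_set)
    have "inj_on (pick I) {0..<card I}" "inj_on (pick J) {0..<card I}"
      using c by (auto intro!: inj_onI elim: pick_inj)
    moreover have "pick I ` {0..<card I} \<subseteq> {0..<dim_row G}" "pick J ` {0..<card I} \<subseteq> {0..<dim_col G}"
      using p I J by fastforce+
    ultimately show ?thesis
      unfolding submatrix_eq_minor_mat[OF I J c] pole_mult_le_iff by (rule assms)
  qed
  then show ?thesis
    unfolding pole_degree_def using fin ne by (subst Max_le_iff) auto
qed

text \<open>Injective selections give a minor from the definition up to sign; a repeated index makes
  the determinant 0, which satisfies every bound.\<close>

lemma val_ge_minor:
  assumes f: "f ` {0..<k} \<subseteq> {0..<dim_row G}" and g: "g ` {0..<k} \<subseteq> {0..<dim_col G}"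
  shows "val_ge \<alpha> (- int (pole_degree G \<alpha>)) (det (minor_mat G k f g))"
proof (cases "inj_on f {0..<k} \<and> inj_on g {0..<k}")
  case True
  let ?D = "{(I, J). I \<subseteq> {..<dim_row G} \<and> J \<subseteq> {..<dim_col G} \<and> card I = card J}"
  let ?M = "{pole_mult (det (submatrix G I J)) \<alpha> | I J.
            I \<subseteq> {..<dim_row G} \<and> J \<subseteq> {..<dim_col G} \<and> card I = card J}"
  have "finite ?D"
    by (rule finite_subset[of _ "Pow {..<dim_row G} \<times> Pow {..<dim_col G}"]) auto
  moreover have "?M = (\<lambda>(I, J). pole_mult (det (submatrix G I J)) \<alpha>) ` ?D" by auto
  ultimately have fin: "finite ?M" by simp
  let ?I = "f ` {0..<k}" and ?J = "g ` {0..<k}"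
  have sub: "?I \<subseteq> {..<dim_row G}" "?J \<subseteq> {..<dim_col G}" using f g by auto
  have "card ?I = card ?J" using True by (simp add: card_image)
  then have "pole_mult (det (submatrix G ?I ?J)) \<alpha> \<in> ?M" using sub by blast
  then have "pole_mult (det (submatrix G ?I ?J)) \<alpha> \<le> pole_degree G \<alpha>"
    unfolding pole_degree_def by (rule Max_ge[OF fin])
  moreover have "det (submatrix G ?I ?J) \<in> {det (minor_mat G k f g), - det (minor_mat G k f g)}"
    using True sub by (intro det_minor_eq_submatrix) auto
  ultimately show ?thesis by (auto simp: pole_mult_le_iff)
next
  case False
  then have "det (minor_mat G k f g) = 0"
    using det_minor_not_inj_rows det_minor_not_inj_cols by blast
  then show ?thesis by simp
qed

text \<open>By Cauchy-Binet a minor of the product is, up to a factorial, a sum of products of a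
  minor of \<open>A\<close> and a minor of \<open>B\<close>.\<close>

lemma pole_degree_mult:
  assumes A: "A \<in> carrier_mat m n" and B: "B \<in> carrier_mat n l"
  shows "pole_degree (A * B) \<alpha> \<le> pole_degree A \<alpha> + pole_degree B \<alpha>"
proof (rule pole_degree_leI)
  fix k and f g :: "nat \<Rightarrow> nat"
  assume f: "f ` {0..<k} \<subseteq> {0..<dim_row (A * B)}" and g: "g ` {0..<k} \<subseteq> {0..<dim_col (A * B)}"
  let ?d = "- int (pole_degree A \<alpha> + pole_degree B \<alpha>)"
  have d: "?d = - int (pole_degree A \<alpha>) + - int (pole_degree B \<alpha>)" by simp
  have f': "f ` {0..<k} \<subseteq> {0..<m}" and g': "g ` {0..<k} \<subseteq> {0..<l}" using f g A B by auto
  have "val_ge \<alpha> ?d (of_nat (fact k) * det (minor_mat (A * B) k f g))"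
    unfolding cauchy_binet_fact[OF A B f' g'] d
  proof (intro val_ge_sum val_ge_mult val_ge_minor)
    fix h assume "h \<in> {h. (\<forall>i\<in>{0..<k}. h i \<in> {0..<n}) \<and> (\<forall>i. i \<notin> {0..<k} \<longrightarrow> h i = i)}"
    then show "h ` {0..<k} \<subseteq> {0..<dim_col A}" "h ` {0..<k} \<subseteq> {0..<dim_row B}"
      using A B by auto
  qed (use f' g' A B in auto)
  then show "val_ge \<alpha> ?d (det (minor_mat (A * B) k f g))"
    by (subst (asm) val_ge_of_nat_mult_iff) simp_all
qed

lemma val_ge_det:
  assumes "M \<in> carrier_mat k k" "\<And>i j. i < k \<Longrightarrow> j < k \<Longrightarrow> val_ge \<alpha> 0 (M $$ (i, j))"
  shows "val_ge \<alpha> 0 (det M)"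
  unfolding det_def'[OF assms(1)]
proof (rule val_ge_sum)
  fix p assume "p \<in> {p. p permutes {0..<k}}"
  then have "p i < k" if "i < k" for i using that permutes_in_image[of p "{0..<k}" i] by simp
  then have "val_ge \<alpha> 0 (\<Prod>i=0..<k. M $$ (i, p i))"
    by (intro val_ge_prod assms(2)) auto
  then show "val_ge \<alpha> 0 (signof p * (\<Prod>i=0..<k. M $$ (i, p i)))" by (simp add: sign_def)
qed

text \<open>Entries are minors of size 1; conversely a determinant is a polynomial in the entries
  and has no pole where they have none.\<close>

lemma pole_degree_eq_0_iff: "pole_degree G \<alpha> = 0 \<longleftrightarrow> \<alpha> \<notin> poles G"
proof
  assume 0: "pole_degree G \<alpha> = 0"
  have "pole_mult (G $$ (i, j)) \<alpha> = 0" if "i < dim_row G" "j < dim_col G" for i j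
  proof -
    have "det (minor_mat G 1 (\<lambda>_. i) (\<lambda>_. j)) = G $$ (i, j)"
      by (subst det_single) (auto simp: minor_mat_def)
    moreover have "val_ge \<alpha> (- int (pole_degree G \<alpha>)) (det (minor_mat G 1 (\<lambda>_. i) (\<lambda>_. j)))"
      using that by (intro val_ge_minor) auto
    ultimately show ?thesis using 0 pole_mult_le_iff[of "G $$ (i, j)" \<alpha> 0] by simp
  qed
  then show "\<alpha> \<notin> poles G" by (auto simp: poles_def)
next
  assume "\<alpha> \<notin> poles G"
  then have "val_ge \<alpha> 0 (G $$ (i, j))" if "i < dim_row G" "j < dim_col G" for i j
    using that pole_mult_le_iff[of "G $$ (i, j)" \<alpha> 0] by (auto simp: poles_def)
  then have "pole_degree G \<alpha> \<le> 0"
    by (intro pole_degree_leI, simp, intro val_ge_det) (auto simp: image_subset_iff)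
  then show "pole_degree G \<alpha> = 0" by simp
qed

lemma finite_poles: "finite (poles G)"
proof -
  have "finite {\<alpha>. pole_mult f \<alpha> > 0}" for f
  proof (rule finite_subset)
    let ?q = "map_poly complex_of_real (snd (quot_of_fract f))"
    show "{\<alpha>. pole_mult f \<alpha> > 0} \<subseteq> insert Infinity (Finite ` {x. poly ?q x = 0})"
    proof
      fix \<alpha> assume "\<alpha> \<in> {\<alpha>. pole_mult f \<alpha> > 0}"
      then show "\<alpha> \<in> insert Infinity (Finite ` {x. poly ?q x = 0})"
        by (cases \<alpha>) (auto simp: order_root)
    qed
    show "finite (insert Infinity (Finite ` {x. poly ?q x = 0}))"
      by (simp add: poly_roots_finite)
  qed
  moreover have "poles G = (\<Union>i<dim_row G. \<Union>j<dim_col G. {\<alpha>. pole_mult (G $$ (i, j)) \<alpha> > 0})"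
    by (auto simp: poles_def)
  ultimately show ?thesis by simp
qed

text \<open>Points that are not poles contribute 0. Degrees of several matrices can thus be compared
  as sums over one common set.\<close>

lemma mcmillan_degree_superset:
  assumes "finite S" "poles G \<subseteq> S"
  shows "mcmillan_degree G = (\<Sum>\<alpha>\<in>S. pole_degree G \<alpha>)"
  unfolding mcmillan_degree_def
  by (rule sum.mono_neutral_left) (use assms in \<open>auto simp: pole_degree_eq_0_iff\<close>)

section \<open>Para-conjugates, inverses and local units\<close>

lemma para_conj_dim [simp]: "dim_row (para_conj G) = dim_col G" "dim_col (para_conj G) = dim_row G"
  by (simp_all add: para_conj_def)

lemma para_conj_carrier: "G \<in> carrier_mat m n \<Longrightarrow> para_conj G \<in> carrier_mat n m"
  by auto

lemma para_conj_index [simp]: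
  "i < dim_col G \<Longrightarrow> j < dim_row G \<Longrightarrow> para_conj G $$ (i, j) = rat_reflect (G $$ (j, i))"
  by (simp add: para_conj_def)

lemma para_conj_involutive [simp]: "para_conj (para_conj G) = G"
  by (rule eq_matI) auto

lemma para_conj_mult:
  assumes "A \<in> carrier_mat m n" "B \<in> carrier_mat n l"
  shows "para_conj (A * B) = para_conj B * para_conj A"
  unfolding para_conj_def rat_reflect.mat_hom_mult[OF assms]
  using assms by (intro transpose_mult) auto

lemma para_conj_one [simp]: "para_conj (1\<^sub>m n) = 1\<^sub>m n"
  by (rule eq_matI) auto

text \<open>Minors of \<open>para_conj G\<close> are reflected minors of \<open>G\<close> with rows
  and columns exchanged. This gives one inequality; the involution gives the other.\<close>

lemma pole_degree_para_conj: "pole_degree (para_conj G) \<alpha> = pole_degree G (ext_inverse \<alpha>)"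
proof -
  have le: "pole_degree (para_conj G) \<alpha> \<le> pole_degree G (ext_inverse \<alpha>)" for G \<alpha>
  proof (rule pole_degree_leI)
    fix k and f g :: "nat \<Rightarrow> nat"
    assume f: "f ` {0..<k} \<subseteq> {0..<dim_row (para_conj G)}" and g: "g ` {0..<k} \<subseteq> {0..<dim_col (para_conj G)}"
    have "minor_mat (para_conj G) k f g = transpose_mat (map_mat rat_reflect (minor_mat G k g f))"
      using f g by (intro eq_matI) (auto simp: image_subset_iff)
    then have d: "det (minor_mat (para_conj G) k f g) = rat_reflect (det (minor_mat G k g f))"
      by (simp add: det_transpose[of _ k])
    have "val_ge (ext_inverse \<alpha>) (- int (pole_degree G (ext_inverse \<alpha>))) (det (minor_mat G k g f))"
      using f g by (intro val_ge_minor) auto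
    then show "val_ge \<alpha> (- int (pole_degree G (ext_inverse \<alpha>))) (det (minor_mat (para_conj G) k f g))"
      unfolding d by (cases "det (minor_mat G k g f) = 0") (auto simp: val_ge_def rat_val_reflect)
  qed
  from le[of G \<alpha>] le[of "para_conj G" "ext_inverse \<alpha>"] show ?thesis by simp
qed

text \<open>By Jacobi's theorem a minor of \<open>B\<close> is, up to sign, a minor of
  \<open>A\<close> divided by \<open>det A\<close>, which gives one inequality. The other comes from
  exchanging \<open>A\<close> and \<open>B\<close>, whose determinants have opposite orders.\<close>

lemma pole_degree_inverse:
  assumes A: "A \<in> carrier_mat n n" and B: "B \<in> carrier_mat n n" and AB: "A * B = 1\<^sub>m n"
  shows "int (pole_degree B \<alpha>) = int (pole_degree A \<alpha>) + rat_val \<alpha> (det A)"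
proof -
  have le: "int (pole_degree B \<alpha>) \<le> int (pole_degree A \<alpha>) + rat_val \<alpha> (det A)"
    if A: "A \<in> carrier_mat n n" and B: "B \<in> carrier_mat n n" and AB: "A * B = 1\<^sub>m n" for A B
  proof -
    let ?N = "int (pole_degree A \<alpha>) + rat_val \<alpha> (det A)"
    have "det A * det B = 1" using det_mult[OF A B] AB by simp
    then have nz: "det A \<noteq> 0" by auto
    \<comment> \<open>\<open>det A\<close> is itself a minor of \<open>A\<close>, so
      \<open>?N\<close> is nonnegative and \<open>nat ?N\<close> loses nothing.\<close>
    have "minor_mat A n id id = A" using A by (intro eq_matI) auto
    then have "val_ge \<alpha> (- int (pole_degree A \<alpha>)) (det A)"
      using val_ge_minor[of id n A id \<alpha>] A by simp
    then have N: "?N \<ge> 0" using nz by (simp add: val_ge_def)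
    have "pole_degree B \<alpha> \<le> nat ?N"
    proof (rule pole_degree_leI)
      fix k and f g :: "nat \<Rightarrow> nat"
      assume inj: "inj_on f {0..<k}" "inj_on g {0..<k}"
        and "f ` {0..<k} \<subseteq> {0..<dim_row B}" "g ` {0..<k} \<subseteq> {0..<dim_col B}"
      then have fg: "f ` {0..<k} \<subseteq> {0..<n}" "g ` {0..<k} \<subseteq> {0..<n}" using B by auto
      from jacobi_complementary_minor[OF A B AB inj(1) fg(1) inj(2) fg(2)]
      obtain l f' g' where fg': "f' ` {0..<l} \<subseteq> {0..<n}" "g' ` {0..<l} \<subseteq> {0..<n}"
        and d: "det (minor_mat A l f' g') \<in> {det A * det (minor_mat B k f g), - (det A * det (minor_mat B k f g))}" .
      have "val_ge \<alpha> (- int (pole_degree A \<alpha>)) (det (minor_mat A l f' g'))"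
        using A fg' by (intro val_ge_minor) auto
      then have "val_ge \<alpha> (- int (pole_degree A \<alpha>)) (det A * det (minor_mat B k f g))"
        using d by auto
      then show "val_ge \<alpha> (- int (nat ?N)) (det (minor_mat B k f g))"
        using nz N by (cases "det (minor_mat B k f g) = 0") (auto simp: val_ge_def rat_val_mult)
    qed
    then show ?thesis using N by linarith
  qed
  have BA: "B * A = 1\<^sub>m n" by (rule mat_mult_left_right_inverse[OF A B AB])
  have d: "det A * det B = 1" using det_mult[OF A B] AB by simp
  then have "det A \<noteq> 0" "det B \<noteq> 0" by auto
  then have "rat_val \<alpha> (det A) + rat_val \<alpha> (det B) = 0" by (metis d rat_val_1 rat_val_mult)
  with le[OF A B AB] le[OF B A BA] show ?thesis by linarith
qed

text \<open>Multiplying by \<open>W\<close> and undoing it by \<open>L\<close> cannot raise the pole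
  degree at a point where both are free of poles.\<close>

lemma pole_degree_left_unit:
  assumes W: "W \<in> carrier_mat m r" and L: "L \<in> carrier_mat r m" and LW: "L * W = 1\<^sub>m r"
    and Q: "Q \<in> carrier_mat r c" and "\<alpha> \<notin> poles W" "\<alpha> \<notin> poles L"
  shows "pole_degree (W * Q) \<alpha> = pole_degree Q \<alpha>"
proof (rule antisym)
  have 0: "pole_degree W \<alpha> = 0" "pole_degree L \<alpha> = 0" using assms by (simp_all add: pole_degree_eq_0_iff)
  show "pole_degree (W * Q) \<alpha> \<le> pole_degree Q \<alpha>" using pole_degree_mult[OF W Q, of \<alpha>] 0 by simp
  have "L * (W * Q) = Q" using assoc_mult_mat[OF L W Q] LW Q by simp
  moreover have "W * Q \<in> carrier_mat m c" using W Q by simp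
  ultimately show "pole_degree Q \<alpha> \<le> pole_degree (W * Q) \<alpha>"
    using pole_degree_mult[OF L, of "W * Q" c \<alpha>] 0 by simp
qed

lemma pole_degree_right_unit:
  assumes W: "W \<in> carrier_mat m r" and U: "U \<in> carrier_mat r r" and V: "V \<in> carrier_mat r r"
    and UV: "U * V = 1\<^sub>m r" and "\<alpha> \<notin> poles U" "\<alpha> \<notin> poles V"
  shows "pole_degree (W * U) \<alpha> = pole_degree W \<alpha>"
proof (rule antisym)
  have 0: "pole_degree U \<alpha> = 0" "pole_degree V \<alpha> = 0" using assms by (simp_all add: pole_degree_eq_0_iff)
  show "pole_degree (W * U) \<alpha> \<le> pole_degree W \<alpha>" using pole_degree_mult[OF W U, of \<alpha>] 0 by simp
  have "W * U * V = W" using assoc_mult_mat[OF W U V] UV W by simp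
  moreover have "W * U \<in> carrier_mat m r" using W U by simp
  ultimately show "pole_degree W \<alpha> \<le> pole_degree (W * U) \<alpha>"
    using pole_degree_mult[of "W * U" m r V r \<alpha>] V 0 by simp
qed

section \<open>All-pass matrices\<close>

text \<open>On the unit circle \<open>1/x\<close> is the conjugate of \<open>x\<close>, and
  conjugation commutes with polynomials having real coefficients.\<close>

lemma rat_eval_reflect_circle:
  assumes x: "cmod x = 1" and f: "regular_at complex_of_real f x"
  shows "regular_at complex_of_real (rat_reflect f) x"
    and "rat_eval complex_of_real (rat_reflect f) x = cnj (rat_eval complex_of_real f x)"
proof -
  have h: "field_hom complex_of_real" ..
  define p q where "p = fst (quot_of_fract f)" and "q = snd (quot_of_fract f)"
  have q: "q \<noteq> 0" by (simp add: q_def)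
  have qx: "poly (map_poly complex_of_real q) x \<noteq> 0" using f by (simp add: regular_at_def q_def)
  have x0: "x \<noteq> 0" using x by auto
  have "x * cnj x = 1" using complex_norm_square[of x] x by simp
  then have ix: "inverse x = cnj x" by (rule inverse_unique)
  have ref: "poly (map_poly complex_of_real (reflect_poly s)) x = x ^ degree s * cnj (poly (map_poly complex_of_real s) x)" for s
  proof -
    have "map_poly complex_of_real (reflect_poly s) = reflect_poly (map_poly complex_of_real s)"
      by (rule poly_eqI) (simp add: coeff_reflect_poly)
    moreover have "cnj (poly (map_poly complex_of_real s) x) = poly (map_poly complex_of_real s) (cnj x)"
      by (induction s) (simp_all add: complex_poly.map_poly_pCons_hom)
    ultimately show ?thesis by (simp add: poly_reflect_poly_nz[OF x0] ix)
  qed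
  define X :: "real poly" where "X = [:0, 1:]"
  have X: "poly (map_poly complex_of_real (X ^ n)) x = x ^ n" for n
    by (simp add: X_def complex_poly.hom_power complex_poly.map_poly_pCons_hom)
  have fpq: "f = to_fract p / to_fract q" unfolding p_def q_def by (rule ratfun_quot)
  have X0: "to_fract X \<noteq> 0" by (simp add: X_def)
  have pow: "to_fract (X ^ n) = to_fract X ^ n" for n by (induction n) auto
  \<comment> \<open>Clearing the powers of \<open>1/z\<close> leaves a quotient of polynomials whose
    denominator does not vanish at \<open>x\<close>.\<close>
  have eq: "rat_reflect f = to_fract (reflect_poly p * X ^ degree q) / to_fract (reflect_poly q * X ^ degree p)"
    using q X0 by (simp add: fpq rat_reflect.hom_div rat_reflect_to_fract zvar_def pow X_def[symmetric])
  have nz: "poly (map_poly complex_of_real (reflect_poly q * X ^ degree p)) x \<noteq> 0"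
    using qx x0 by (simp add: complex_poly.hom_mult ref X)
  show "regular_at complex_of_real (rat_reflect f) x"
    unfolding eq by (rule rat_eval_frac(1)[OF h nz])
  have "rat_eval complex_of_real f x = poly (map_poly complex_of_real p) x / poly (map_poly complex_of_real q) x"
    unfolding fpq by (rule rat_eval_frac(2)[OF h qx])
  then show "rat_eval complex_of_real (rat_reflect f) x = cnj (rat_eval complex_of_real f x)"
    unfolding eq rat_eval_frac(2)[OF h nz]
    using qx x0 by (simp add: complex_poly.hom_mult ref X)
qed

text \<open>On the unit circle an all-pass matrix is unitary, hence bounded.\<close>

lemma all_pass_no_circle_poles:
  assumes G: "all_pass r G" and a: "cmod a = 1"
  shows "Finite a \<notin> poles G"
proof
  assume "Finite a \<in> poles G"
  moreover have Gc: "G \<in> carrier_mat r r" using G by (simp add: all_pass_def)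
  ultimately obtain i j where ij: "i < r" "j < r" "pole_mult (G $$ (i, j)) (Finite a) > 0"
    by (auto simp: poles_def)
  have h: "field_hom complex_of_real" ..
  define p q where "p = (\<lambda>k. map_poly complex_of_real (fst (quot_of_fract (G $$ (k, j)))))"
    and "q = (\<lambda>k. map_poly complex_of_real (snd (quot_of_fract (G $$ (k, j)))))"
  have q0: "q k \<noteq> 0" for k by (simp add: q_def)
  have qa: "poly (q i) a = 0" using ij(3) by (auto simp: q_def order_root)
  then have pa: "poly (p i) a \<noteq> 0"
    using coprime_complex_polys[OF coprime_quot_of_fract, of "G $$ (i, j)" a] by (auto simp: p_def q_def)
  define F where "F = (\<Union>k<r. {x. poly (q k) x = 0})"
  have F: "finite F" using q0 by (auto simp: F_def poly_roots_finite)
  have "para_conj G * G = 1\<^sub>m r" using G by (simp add: all_pass_def)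
  then have "(para_conj G * G) $$ (j, j) = 1" using ij by simp
  then have sum1: "(\<Sum>k=0..<r. rat_reflect (G $$ (k, j)) * G $$ (k, j)) = 1"
    using Gc ij by (simp add: scalar_prod_def)
  \<comment> \<open>Entry \<open>(j, j)\<close> of \<open>para_conj G * G = 1\<^sub>m r\<close> says
    that the squared moduli in column \<open>j\<close> sum to 1 on the circle off \<open>F\<close>,
    so no entry of the column exceeds 1 in modulus there.\<close>
  have le: "cmod (poly (p i) x) \<le> cmod (poly (q i) x)" if x: "cmod x = 1" "x \<notin> F" for x
  proof -
    let ?e = "\<lambda>k. rat_eval complex_of_real (G $$ (k, j)) x"
    have reg: "regular_at complex_of_real (G $$ (k, j)) x" if "k < r" for k
      using x that by (auto simp: F_def regular_at_def q_def)
    note ref = rat_eval_reflect_circle[OF x(1) reg]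
    have "rat_eval complex_of_real (\<Sum>k=0..<r. rat_reflect (G $$ (k, j)) * G $$ (k, j)) x
        = (\<Sum>k=0..<r. cnj (?e k) * ?e k)"
      by (subst rat_eval_sum[OF h]) (auto intro!: sum.cong simp: rat_eval_mult[OF h] regular_at_mult[OF h] reg ref)
    then have "(\<Sum>k=0..<r. cnj (?e k) * ?e k) = 1"
      using rat_eval_to_fract(2)[OF h, of 1 x] by (simp add: sum1)
    moreover have "cnj (?e k) * ?e k = complex_of_real ((cmod (?e k))\<^sup>2)" for k
      by (metis complex_norm_square mult.commute)
    ultimately have "complex_of_real (\<Sum>k=0..<r. (cmod (?e k))\<^sup>2) = 1" by simp
    then have s: "(\<Sum>k=0..<r. (cmod (?e k))\<^sup>2) = 1" by (simp only: of_real_eq_1_iff)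
    have "(cmod (?e i))\<^sup>2 \<le> (\<Sum>k=0..<r. (cmod (?e k))\<^sup>2)"
      by (rule member_le_sum) (use ij in auto)
    then have "cmod (?e i) \<le> 1" using power2_le_imp_le[of "cmod (?e i)" 1] by (simp add: s)
    moreover have "?e i = poly (p i) x / poly (q i) x"
      by (simp add: rat_eval_def case_prod_unfold p_def q_def)
    moreover have "poly (q i) x \<noteq> 0" using x ij by (auto simp: F_def)
    ultimately show ?thesis by (simp add: norm_divide)
  qed
  \<comment> \<open>Points of the circle that tend to \<open>a\<close> without reaching it. They
    eventually avoid the finite set \<open>F\<close>, so the bound passes to the limit and forces
    the numerator to vanish at \<open>a\<close>, against coprimality.\<close>
  define x where "x n = a * cis (1 / real (Suc n))" for n
  have "(\<lambda>n. 1 / real (Suc n)) \<longlonglongrightarrow> 0" by (rule LIMSEQ_Suc[OF lim_1_over_n])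
  then have "(\<lambda>n. cis (1 / real (Suc n))) \<longlonglongrightarrow> cis 0" by (intro tendsto_cis)
  then have lim: "x \<longlonglongrightarrow> a" unfolding x_def using tendsto_mult_left[of _ 1 sequentially a] by simp
  have xa: "x n \<noteq> a" for n
  proof
    assume "x n = a"
    moreover have "a \<noteq> 0" using a by auto
    ultimately have "cis (1 / real (Suc n)) = 1" by (simp add: x_def)
    then have "Im (cis (1 / real (Suc n))) = Im 1" by (rule arg_cong)
    then have "sin (1 / real (Suc n)) = 0" by simp
    moreover have "sin (1 / real (Suc n)) > 0" by (rule sin_gt_zero_02) (auto simp: field_simps)
    ultimately show False by simp
  qed
  have "\<forall>\<^sub>F n in sequentially. x n \<noteq> y" for y
    by (cases "y = a") (use xa lim in \<open>auto intro: tendsto_imp_eventually_ne\<close>)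
  then have "\<forall>\<^sub>F n in sequentially. \<forall>y\<in>F. x n \<noteq> y"
    by (intro eventually_ball_finite[OF F]) auto
  then have "\<forall>\<^sub>F n in sequentially. cmod (poly (p i) (x n)) \<le> cmod (poly (q i) (x n))"
    by eventually_elim (rule le, use a in \<open>auto simp: x_def norm_mult\<close>)
  moreover have "(\<lambda>n. cmod (poly s (x n))) \<longlonglongrightarrow> cmod (poly s a)" for s
    by (intro tendsto_norm isCont_tendsto_compose[OF _ lim]) simp
  ultimately have "cmod (poly (p i) a) \<le> cmod (poly (q i) a)"
    by (intro tendsto_le[OF sequentially_bot]) auto
  then show False using pa qa by simp
qed

section \<open>The degree formula\<close>

lemma all_pass_one: "all_pass r (1\<^sub>m r)"
  by (simp add: all_pass_def)

lemma all_pass_para_conj: "all_pass r G \<Longrightarrow> all_pass r (para_conj G)"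
  by (auto simp: all_pass_def)

lemma all_pass_mult:
  assumes "all_pass r G" "all_pass r H"
  shows "all_pass r (G * H)"
proof -
  have c: "G \<in> carrier_mat r r" "H \<in> carrier_mat r r" "para_conj G \<in> carrier_mat r r" "para_conj H \<in> carrier_mat r r"
    and e: "G * para_conj G = 1\<^sub>m r" "H * para_conj H = 1\<^sub>m r"
    using assms by (auto simp: all_pass_def)
  have "G * H * para_conj (G * H) = G * (H * (para_conj H * para_conj G))"
    using c by (simp add: para_conj_mult[of _ r r _ r] assoc_mult_mat[of _ r r _ r _ r])
  also have "H * (para_conj H * para_conj G) = H * para_conj H * para_conj G"
    by (rule assoc_mult_mat[OF c(2,4,3), symmetric])
  finally have right: "G * H * para_conj (G * H) = 1\<^sub>m r"
    by (simp only: e left_mult_one_mat[OF c(3)])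
  have GH: "G * H \<in> carrier_mat r r" by (rule mult_carrier_mat[OF c(1,2)])
  have "para_conj (G * H) * (G * H) = 1\<^sub>m r"
    by (rule mat_mult_left_right_inverse[OF GH para_conj_carrier[OF GH] right])
  with GH right show ?thesis by (simp add: all_pass_def)
qed

text \<open>With \<open>Q = L * W\<close>, multiplying \<open>eq\<close> on the right by
  \<open>para_conj L\<close> gives \<open>W * para_conj Q = W0\<close>. Then
  \<open>Q * para_conj Q = L * W0\<close> is the identity, and since \<open>Q\<close> is square the
  product in the other order is too.\<close>

lemma spectral_factors_all_pass_related:
  assumes W0: "W0 \<in> carrier_mat m r" and L: "L \<in> carrier_mat r m" and W: "W \<in> carrier_mat m r"
    and LW0: "L * W0 = 1\<^sub>m r" and eq: "W * para_conj W = W0 * para_conj W0"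
  shows "all_pass r (L * W)" and "W0 * (L * W) = W"
proof -
  let ?Q = "L * W"
  have c: "para_conj W \<in> carrier_mat r m" "para_conj W0 \<in> carrier_mat r m" "para_conj L \<in> carrier_mat m r"
    using assms by auto
  have Q: "?Q \<in> carrier_mat r r" "para_conj ?Q \<in> carrier_mat r r" using L W by auto
  have "W * para_conj ?Q = W * para_conj W * para_conj L"
    using W L c by (simp add: para_conj_mult[OF L W] assoc_mult_mat[of _ m r _ m _ r])
  also have "\<dots> = W0 * (para_conj W0 * para_conj L)"
    using W0 L c by (simp add: eq assoc_mult_mat[of _ m r _ m _ r])
  also have "para_conj W0 * para_conj L = 1\<^sub>m r"
    using LW0 by (simp flip: para_conj_mult[OF L W0])
  finally have WQ: "W * para_conj ?Q = W0" using W0 by simp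
  have QQ: "?Q * para_conj ?Q = 1\<^sub>m r"
    using WQ LW0 assoc_mult_mat[OF L W Q(2)] by simp
  have QQ': "para_conj ?Q * ?Q = 1\<^sub>m r"
    by (rule mat_mult_left_right_inverse[OF Q QQ])
  show "all_pass r ?Q" using Q QQ QQ' by (simp add: all_pass_def)
  have "W0 * ?Q = W * (para_conj ?Q * ?Q)"
    using WQ assoc_mult_mat[OF W Q(2) Q(1)] by simp
  then show "W0 * ?Q = W" using QQ' W by simp
qed

section \<open>The extended plane split by the unit circle\<close>

definition unit_circle :: "ext_complex set" where
  "unit_circle = Finite ` {z. cmod z = 1}"

lemma disc_memberships [simp]:
  "Finite a \<in> outside_disc \<longleftrightarrow> 1 < cmod a" "Infinity \<in> outside_disc"
  "Finite a \<in> inside_disc \<longleftrightarrow> cmod a < 1" "Infinity \<notin> inside_disc"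
  "Finite a \<in> unit_circle \<longleftrightarrow> cmod a = 1" "Infinity \<notin> unit_circle"
  by (auto simp: outside_disc_def inside_disc_def unit_circle_def)

lemma ext_complex_cases:
  "\<alpha> \<in> outside_disc \<or> \<alpha> \<in> inside_disc \<or> \<alpha> \<in> unit_circle"
  by (cases \<alpha>) auto

lemma discs_disjoint:
  "outside_disc \<inter> inside_disc = {}" "outside_disc \<inter> unit_circle = {}" "inside_disc \<inter> unit_circle = {}"
  by (auto simp: outside_disc_def inside_disc_def unit_circle_def)

lemma ext_inverse_inside_disc: "ext_inverse \<alpha> \<in> outside_disc \<longleftrightarrow> \<alpha> \<in> inside_disc"
  by (cases \<alpha>) (auto simp: norm_divide field_simps)

lemma ext_inverse_outside_disc: "ext_inverse \<alpha> \<in> inside_disc \<longleftrightarrow> \<alpha> \<in> outside_disc"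
  by (metis ext_inverse_inside_disc ext_inverse_involutive)

text \<open>Inversion exchanges the exterior and the interior of the disc, so on a set closed under
  it the interior terms can be carried to the exterior.\<close>

lemma sum_discs:
  fixes h :: "ext_complex \<Rightarrow> int"
  assumes S: "finite S" and inv: "ext_inverse ` S \<subseteq> S"
  shows "sum h S = (\<Sum>\<alpha>\<in>S \<inter> outside_disc. h \<alpha> + h (ext_inverse \<alpha>)) + sum h (S \<inter> unit_circle)"
proof -
  have "S = (S \<inter> outside_disc \<union> S \<inter> inside_disc) \<union> S \<inter> unit_circle"
    using ext_complex_cases by blast
  moreover have "(S \<inter> outside_disc \<union> S \<inter> inside_disc) \<inter> (S \<inter> unit_circle) = {}"
    using discs_disjoint by blast
  moreover have "finite (S \<inter> outside_disc \<union> S \<inter> inside_disc)" "finite (S \<inter> unit_circle)"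
    using S by simp_all
  ultimately have "sum h S = sum h (S \<inter> outside_disc \<union> S \<inter> inside_disc) + sum h (S \<inter> unit_circle)"
    using sum.union_disjoint[of "S \<inter> outside_disc \<union> S \<inter> inside_disc" "S \<inter> unit_circle" h] by simp
  also have "sum h (S \<inter> outside_disc \<union> S \<inter> inside_disc) = sum h (S \<inter> outside_disc) + sum h (S \<inter> inside_disc)"
    by (rule sum.union_disjoint) (use S discs_disjoint(1) in blast)+
  also have "sum h (S \<inter> inside_disc) = (\<Sum>\<alpha>\<in>S \<inter> outside_disc. h (ext_inverse \<alpha>))"
  proof (rule sum.reindex_bij_witness[of _ ext_inverse ext_inverse])
    show "ext_inverse \<alpha> \<in> S \<inter> outside_disc" if "\<alpha> \<in> S \<inter> inside_disc" for \<alpha>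
      using that inv by (simp add: ext_inverse_inside_disc image_subset_iff)
    show "ext_inverse \<alpha> \<in> S \<inter> inside_disc" if "\<alpha> \<in> S \<inter> outside_disc" for \<alpha>
      using that inv by (simp add: ext_inverse_outside_disc image_subset_iff)
  qed simp_all
  finally show ?thesis by (simp add: sum.distrib)
qed

lemma all_pass_no_unit_circle_poles:
  "all_pass r G \<Longrightarrow> \<alpha> \<in> unit_circle \<Longrightarrow> \<alpha> \<notin> poles G"
  using all_pass_no_circle_poles by (auto simp: unit_circle_def)

text \<open>Outside the disc the pole degree of \<open>W0 Tl\<close> is that of \<open>Tl\<close>, inside it is that of \<open>Tr\<^sup>*\<close>
  since \<open>W0 Tl = W1 Tr\<^sup>*\<close>, and on the circle it is that of \<open>W0\<close>.\<close>

lemma mcmillan_degree_factor_mult_all_pass: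
  assumes W0: "W0 \<in> carrier_mat m r" and aW0: "analytic_with_left_inverse W0 outside_disc"
    and W1: "W1 \<in> carrier_mat m r" and aW1: "analytic_with_left_inverse W1 inside_disc"
    and Tl: "all_pass r Tl" and Tr: "all_pass r Tr" and fac: "W1 = W0 * (Tl * Tr)"
    and S: "finite S" "ext_inverse ` S \<subseteq> S" "poles (W0 * Tl) \<subseteq> S"
  shows "int (mcmillan_degree (W0 * Tl)) =
    (\<Sum>\<alpha>\<in>S \<inter> outside_disc. int (pole_degree Tl \<alpha>) + int (pole_degree Tr \<alpha>))
    + (\<Sum>\<alpha>\<in>S \<inter> unit_circle. int (pole_degree W0 \<alpha>))"
proof -
  have c: "Tl \<in> carrier_mat r r" "Tr \<in> carrier_mat r r" "para_conj Tl \<in> carrier_mat r r" "para_conj Tr \<in> carrier_mat r r"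
    and e: "Tl * para_conj Tl = 1\<^sub>m r" "Tr * para_conj Tr = 1\<^sub>m r"
    using Tl Tr by (auto simp: all_pass_def)
  obtain L0 where L0: "L0 \<in> carrier_mat r m" "L0 * W0 = 1\<^sub>m r" "poles L0 \<inter> outside_disc = {}"
      "poles W0 \<inter> outside_disc = {}"
    using aW0 W0 by (auto simp: analytic_with_left_inverse_def left_inverse_of_def analytic_in_def)
  obtain L1 where L1: "L1 \<in> carrier_mat r m" "L1 * W1 = 1\<^sub>m r" "poles L1 \<inter> inside_disc = {}"
      "poles W1 \<inter> inside_disc = {}"
    using aW1 W1 by (auto simp: analytic_with_left_inverse_def left_inverse_of_def analytic_in_def)
  have "Tl * Tr * para_conj Tr = Tl"
    using c e by (simp add: assoc_mult_mat[of _ r r _ r _ r])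
  then have W: "W0 * Tl = W1 * para_conj Tr"
    unfolding fac using W0 c by (simp add: assoc_mult_mat[of _ m r _ r _ r])
  have out: "pole_degree (W0 * Tl) \<alpha> = pole_degree Tl \<alpha>" if "\<alpha> \<in> outside_disc" for \<alpha>
    by (rule pole_degree_left_unit[OF W0 L0(1,2) c(1)]) (use that L0 in auto)
  \<comment> \<open>Inside the disc \<open>W1\<close> is a unit, and the pole degree of
    \<open>para_conj Tr\<close> at the inverse of \<alpha> is that of \<open>Tr\<close> at
    \<alpha>.\<close>
  have inn: "pole_degree (W0 * Tl) (ext_inverse \<alpha>) = pole_degree Tr \<alpha>" if "\<alpha> \<in> outside_disc" for \<alpha>
  proof -
    have "ext_inverse \<alpha> \<in> inside_disc" using that by (simp add: ext_inverse_outside_disc)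
    then have "pole_degree (W1 * para_conj Tr) (ext_inverse \<alpha>) = pole_degree (para_conj Tr) (ext_inverse \<alpha>)"
      by (intro pole_degree_left_unit[OF W1 L1(1,2) c(4)]) (use L1 in auto)
    then show ?thesis by (simp add: W pole_degree_para_conj)
  qed
  have circ: "pole_degree (W0 * Tl) \<alpha> = pole_degree W0 \<alpha>" if "\<alpha> \<in> unit_circle" for \<alpha>
    using that Tl all_pass_para_conj[OF Tl]
    by (intro pole_degree_right_unit[OF W0 c(1) c(3) e(1)]) (auto simp: all_pass_no_unit_circle_poles)
  have "int (mcmillan_degree (W0 * Tl)) = (\<Sum>\<alpha>\<in>S. int (pole_degree (W0 * Tl) \<alpha>))"
    by (simp add: mcmillan_degree_superset[OF S(1,3)])
  then show ?thesis
    unfolding sum_discs[OF S(1,2)] using out inn circ by simp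
qed

text \<open>By \<open>pole_degree_inverse\<close> and multiplicativity of the determinant, the defect at \<open>1/\<alpha>\<close>
  equals the defect at \<open>\<alpha>\<close>.\<close>

lemma mcmillan_degree_all_pass_mult:
  assumes Tl: "all_pass r Tl" and Tr: "all_pass r Tr"
    and S: "finite S" "ext_inverse ` S \<subseteq> S"
      "poles Tl \<subseteq> S" "poles Tr \<subseteq> S" "poles (Tl * Tr) \<subseteq> S"
  shows "int (mcmillan_degree Tl) + int (mcmillan_degree Tr) - int (mcmillan_degree (Tl * Tr)) =
    2 * (\<Sum>\<alpha>\<in>S \<inter> outside_disc.
      int (pole_degree Tl \<alpha>) + int (pole_degree Tr \<alpha>) - int (pole_degree (Tl * Tr) \<alpha>))"
proof -
  define D where "D \<alpha> = int (pole_degree Tl \<alpha>) + int (pole_degree Tr \<alpha>) - int (pole_degree (Tl * Tr) \<alpha>)" for \<alpha>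
  have T: "all_pass r (Tl * Tr)" by (rule all_pass_mult[OF Tl Tr])
  \<comment> \<open>For an all-pass \<open>G\<close> the inverse is \<open>para_conj G\<close>,
    whose pole degree at \<alpha> is that of \<open>G\<close> at the inverse point.\<close>
  have inv: "int (pole_degree G (ext_inverse \<alpha>)) = int (pole_degree G \<alpha>) + rat_val \<alpha> (det G)"
    and nz: "det G \<noteq> 0" if "all_pass r G" for G \<alpha>
  proof -
    have c: "G \<in> carrier_mat r r" "para_conj G \<in> carrier_mat r r" "G * para_conj G = 1\<^sub>m r"
      using that by (auto simp: all_pass_def)
    show "int (pole_degree G (ext_inverse \<alpha>)) = int (pole_degree G \<alpha>) + rat_val \<alpha> (det G)"
      using pole_degree_inverse[OF c] by (simp add: pole_degree_para_conj)
    show "det G \<noteq> 0" using det_mult[OF c(1,2)] c(3) by auto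
  qed
  have "det (Tl * Tr) = det Tl * det Tr"
    using Tl Tr by (intro det_mult[of _ r]) (auto simp: all_pass_def)
  then have sym: "D (ext_inverse \<alpha>) = D \<alpha>" for \<alpha>
    by (simp add: D_def inv[OF Tl] inv[OF Tr] inv[OF T] nz[OF Tl] nz[OF Tr] rat_val_mult)
  have circ: "D \<alpha> = 0" if "\<alpha> \<in> unit_circle" for \<alpha>
    using all_pass_no_unit_circle_poles[OF _ that] Tl Tr T
    by (simp add: D_def pole_degree_eq_0_iff[THEN iffD2])
  have "int (mcmillan_degree Tl) + int (mcmillan_degree Tr) - int (mcmillan_degree (Tl * Tr)) = sum D S"
    by (simp add: mcmillan_degree_superset[OF S(1)] S D_def sum.distrib sum_subtractf)
  also have "\<dots> = 2 * sum D (S \<inter> outside_disc)"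
    unfolding sum_discs[OF S(1,2)] by (simp add: sym circ sum_distrib_left)
  finally show ?thesis by (simp add: D_def)
qed

text \<open>The degree formula is applied to two factorizations of \<open>Tl * Tr\<close>: the given
  one and the trivial one with left factor 1, which yields the degree of \<open>W0\<close>. In the
  difference the circle terms cancel, and what remains is half the total defect.\<close>

lemma mcmillan_degree_defect:
  assumes W0: "W0 \<in> carrier_mat m r" and aW0: "analytic_with_left_inverse W0 outside_disc"
    and W1: "W1 \<in> carrier_mat m r" and aW1: "analytic_with_left_inverse W1 inside_disc"
    and Tl: "all_pass r Tl" and Tr: "all_pass r Tr" and fac: "W1 = W0 * (Tl * Tr)"
  shows "int (mcmillan_degree Tl) + int (mcmillan_degree Tr) - int (mcmillan_degree (Tl * Tr)) =
    2 * (int (mcmillan_degree (W0 * Tl)) - int (mcmillan_degree W0))"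
proof -
  \<comment> \<open>One finite set closed under inversion carries all the sums, as
    \<open>sum_discs\<close> requires.\<close>
  define P where "P = poles Tl \<union> poles Tr \<union> poles (Tl * Tr) \<union> poles W0 \<union> poles (W0 * Tl)"
  define S where "S = P \<union> ext_inverse ` P"
  have S: "finite S" "ext_inverse ` S \<subseteq> S"
    by (auto simp: S_def P_def finite_poles)
  have sub: "poles Tl \<subseteq> S" "poles Tr \<subseteq> S" "poles (Tl * Tr) \<subseteq> S" "poles W0 \<subseteq> S" "poles (W0 * Tl) \<subseteq> S"
    by (auto simp: S_def P_def)
  have T: "all_pass r (Tl * Tr)" by (rule all_pass_mult[OF Tl Tr])
  have Tc: "Tl * Tr \<in> carrier_mat r r" using T by (simp add: all_pass_def)
  have "poles (1\<^sub>m r) = {}"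
    by (auto simp: poles_def pole_mult_eq)
  then have one: "pole_degree (1\<^sub>m r) \<alpha> = 0" for \<alpha> by (simp add: pole_degree_eq_0_iff)
  have "W1 = W0 * (1\<^sub>m r * (Tl * Tr))" by (simp only: fac left_mult_one_mat[OF Tc])
  from mcmillan_degree_factor_mult_all_pass[OF W0 aW0 W1 aW1 all_pass_one T this S]
  have "int (mcmillan_degree W0) =
    (\<Sum>\<alpha>\<in>S \<inter> outside_disc. int (pole_degree (Tl * Tr) \<alpha>))
    + (\<Sum>\<alpha>\<in>S \<inter> unit_circle. int (pole_degree W0 \<alpha>))"
    using W0 sub by (simp add: one)
  then show ?thesis
    using mcmillan_degree_factor_mult_all_pass[OF W0 aW0 W1 aW1 Tl Tr fac S sub(5)]
      mcmillan_degree_all_pass_mult[OF Tl Tr S sub(1,2,3)]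
    by (simp add: sum_subtractf)
qed

section \<open>Minimal spectral factors and left all-pass divisors\<close>

theorem theorem1:
  fixes \<Phi> W_minus W_plus L T :: "real poly fract mat" and m r :: nat
  assumes "\<Phi> \<in> carrier_mat m m"
    and "spectral_density \<Phi>"
    and "normal_rank \<Phi> = r"
    and "outer_spectral_factor \<Phi> W_minus"
    and "conjugate_outer_spectral_factor \<Phi> W_plus"
    and "left_inverse_of L W_minus"
    and "T = L * W_plus"
  shows "{W. minimal_spectral_factor \<Phi> W} =
         {W_minus * T_l | T_l. left_all_pass_divisor r T_l T}"
proof -
  have Wm: "W_minus \<in> carrier_mat m r" "\<Phi> = W_minus * para_conj W_minus"
      "2 * mcmillan_degree W_minus = mcmillan_degree \<Phi>"
      "analytic_with_left_inverse W_minus outside_disc"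
    using assms(1,3,4)
    by (auto simp: outer_spectral_factor_def minimal_spectral_factor_def spectral_factor_def)
  have Wp: "W_plus \<in> carrier_mat m r" "\<Phi> = W_plus * para_conj W_plus"
      "analytic_with_left_inverse W_plus inside_disc"
    using assms(1,3,5)
    by (auto simp: conjugate_outer_spectral_factor_def minimal_spectral_factor_def spectral_factor_def)
  have L: "L \<in> carrier_mat r m" "L * W_minus = 1\<^sub>m r"
    using assms(6) Wm(1) by (auto simp: left_inverse_of_def)
  \<comment> \<open>\<open>W_minus\<close> is itself minimal, so half the degree of \<Phi> can be
    replaced by its degree.\<close>
  have min_iff: "minimal_spectral_factor \<Phi> W \<longleftrightarrow>
      W \<in> carrier_mat m r \<and> \<Phi> = W * para_conj W \<and> mcmillan_degree W = mcmillan_degree W_minus" for W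
    using assms(1,3) Wm(3) by (auto simp: minimal_spectral_factor_def spectral_factor_def)
  have T: "all_pass r T" "W_minus * T = W_plus"
    using spectral_factors_all_pass_related[OF Wm(1) L(1) Wp(1) L(2)] Wm(2) Wp(2) assms(7) by auto
  note defect = mcmillan_degree_defect[OF Wm(1,4) Wp(1,3)]
  show ?thesis
  proof (intro equalityI subsetI)
    fix W assume "W \<in> {W. minimal_spectral_factor \<Phi> W}"
    then have W: "W \<in> carrier_mat m r" "\<Phi> = W * para_conj W" "mcmillan_degree W = mcmillan_degree W_minus"
      by (auto simp: min_iff)
    \<comment> \<open>\<open>Tr\<close> is the only possible right factor:
      \<open>para_conj Tl\<close> is the inverse of \<open>Tl\<close>.\<close>
    define Tl Tr where "Tl = L * W" and "Tr = para_conj Tl * T"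
    have Tl: "all_pass r Tl" "W_minus * Tl = W"
      using spectral_factors_all_pass_related[OF Wm(1) L(1) W(1) L(2)] Wm(2) W(2)
      by (auto simp: Tl_def)
    have Tr: "all_pass r Tr"
      unfolding Tr_def by (rule all_pass_mult[OF all_pass_para_conj[OF Tl(1)] T(1)])
    have "Tl * Tr = Tl * para_conj Tl * T"
      using Tl(1) T(1) unfolding Tr_def
      by (subst assoc_mult_mat[of _ r r _ r _ r]) (auto simp: all_pass_def)
    moreover have "T \<in> carrier_mat r r" "Tl * para_conj Tl = 1\<^sub>m r"
      using Tl(1) T(1) by (auto simp: all_pass_def)
    ultimately have fac: "T = Tl * Tr" by simp
    \<comment> \<open>\<open>W\<close> and \<open>W_minus\<close> have equal degrees, so the defect
      is 0.\<close>
    have "mcmillan_degree Tl + mcmillan_degree Tr = mcmillan_degree T"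
      using defect[OF Tl(1) Tr] T(2) fac Tl(2) W(3) by simp
    then have "left_all_pass_divisor r Tl T"
      using Tl(1) Tr fac by (auto simp: left_all_pass_divisor_def)
    then show "W \<in> {W_minus * T_l | T_l. left_all_pass_divisor r T_l T}" using Tl(2) by blast
  next
    fix W assume "W \<in> {W_minus * T_l | T_l. left_all_pass_divisor r T_l T}"
    then obtain Tl Tr where W: "W = W_minus * Tl" and Tl: "all_pass r Tl" and Tr: "all_pass r Tr"
      and fac: "T = Tl * Tr" and deg: "mcmillan_degree Tl + mcmillan_degree Tr = mcmillan_degree T"
      by (auto simp: left_all_pass_divisor_def)
    have c: "Tl \<in> carrier_mat r r" "para_conj Tl \<in> carrier_mat r r" "para_conj W_minus \<in> carrier_mat r m"
      and e: "Tl * para_conj Tl = 1\<^sub>m r"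
      using Tl Wm(1) by (auto simp: all_pass_def)
    have "W * para_conj W = W_minus * (Tl * (para_conj Tl * para_conj W_minus))"
      unfolding W using Wm(1) c
      by (simp add: para_conj_mult[of _ m r _ r] assoc_mult_mat[of _ m r _ r _ m])
    also have "Tl * (para_conj Tl * para_conj W_minus) = Tl * para_conj Tl * para_conj W_minus"
      using c by (simp add: assoc_mult_mat[of _ r r _ r _ m])
    also have "\<dots> = para_conj W_minus" by (simp only: e left_mult_one_mat[OF c(3)])
    finally have "\<Phi> = W * para_conj W" using Wm(2) by simp
    moreover have "W \<in> carrier_mat m r" using W Wm(1) c by simp
    \<comment> \<open>The same identity read backwards: a zero defect forces equal degrees.\<close>
    moreover have "mcmillan_degree W = mcmillan_degree W_minus"
      using defect[OF Tl Tr] T(2) fac deg W by simp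
    ultimately show "W \<in> {W. minimal_spectral_factor \<Phi> W}" using min_iff by blast
  qed
qed

end
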